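(* Let $\bm{T}=\big(\bigotimes_{i=1}^m\Phi(\lambda_i,\alpha_i,\beta_i,\gamma_i,h_i(t_i))\big)\otimes V$ and $\bm{T}'=\big(\bigotimes_{j=1}^{m'}\Phi(\lambda_j',\alpha_j',\beta_j',\gamma_j',g_j(t_j))\big)\otimes V'$ be two tensor product $\mathfrak{L}$-modules as described in the context, such that $\lambda_1,\ldots,\lambda_m$ are pairwise distinct and $\lambda_1',\ldots,\lambda_{m'}'$ are pairwise distinct. Then $\bm{T}\cong\bm{T}'$ as $\mathfrak{L}$-modules if and only if $m=m'$, $V\cong V'$ as $\mathfrak{L}$-modules, and, after renumbering the tuples $(\lambda_j',\alpha_j',\beta_j',\gamma_j',g_j)$ by a permutation of $\{1,\ldots,m\}$ if necessary, $$(\lambda_i,\alpha_i,\beta_i,\gamma_i,h_i)=(\lambda_i',\alpha_i',\beta_i',\gamma_i',g_i)\quad\text{for all }1\leq i\leq m$$ (where $h_i=g_i$ means equality as one-variable polynomials).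
   Context: All vector spaces are over $\mathbb{C}$; $\mathbb{C}^*$ denotes the nonzero complex numbers, $\mathbb{Z}_+$ the nonnegative integers, $\mathbb{N}$ the positive integers. The BMS-Kac-Moody algebra $\mathfrak{L}$ is the Lie algebra with basis $\{L_m,W_m,I_m,J_m\mid m\in\mathbb{Z}\}$ and nontrivial brackets $[L_m,L_n]=(n-m)L_{m+n}$, $[L_m,W_n]=(n-m)W_{m+n}$, $[L_m,I_n]=nI_{m+n}$, $[L_m,J_n]=nJ_{m+n}$, $[W_m,I_n]=-nJ_{m+n}$ for $m,n\in\mathbb{Z}$ (all other brackets of basis elements, up to skew-symmetry, are zero). It is $\mathbb{Z}$-graded with $\mathfrak{L}_n=\mathbb{C}L_n\oplus\mathbb{C}W_n\oplus\mathbb{C}I_n\oplus\mathbb{C}J_n$. For $\lambda\in\mathbb{C}^*$, $\alpha,\beta,\gamma\in\mathbb{C}$, $h(t)\in\mathbb{C}[t]$, the $\mathfrak{L}$-module $\Phi(\lambda,\alpha,\beta,\gamma,h(t))$ is the vector space $\mathbb{C}[s,t]$ with, for $f(s,t)\in\mathbb{C}[s,t]$ and $n\in\mathbb{Z}$, $L_n(f(s,t))=\lambda^n(s+h_{(n)}(t))f(s-n,t)-n\lambda^n(t-n\alpha)\frac{\partial}{\partial t}(f(s-n,t))$, $W_n(f(s,t))=\lambda^n(t-n\alpha)f(s-n,t)$, $I_n(f(s,t))=\lambda^n\big(\gamma-n\beta H(t)\big)f(s-n,t)+n\lambda^n\beta\frac{\partial}{\partial t}(f(s-n,t))$, $J_n(f(s,t))=\lambda^n\beta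 f(s-n,t)$, where $H(t)=\frac{h(t)-h(\alpha)}{t-\alpha}$ and $h_{(n)}(t)=nh(t)-n(n-1)\alpha H(t)$. An $\mathfrak{L}$-module $V$ is restricted if for every $v\in V$ there is $k\in\mathbb{Z}_+$ with $\mathfrak{L}_n\cdot v=0$ for all $n\geq k$. Tensor product modules: let $m\in\mathbb{N}$. For $1\leq i\leq m$ let $\gamma_i\in\mathbb{C}$, let $\lambda_i\in\mathbb{C}^*$, $\alpha_i,\beta_i\in\mathbb{C}$ with $\alpha_i\neq0$ or $\beta_i\neq0$, and $h_i(t_i)\in\mathbb{C}[t_i]$; regard $\Phi(\lambda_i,\alpha_i,\beta_i,\gamma_i,h_i(t_i))$ as $\mathbb{C}[s_i,t_i]$. Let $V$ be an irreducible restricted $\mathfrak{L}$-module. Then $\bm{T}=\big(\bigotimes_{i=1}^m\Phi(\lambda_i,\alpha_i,\beta_i,\gamma_i,h_i(t_i))\big)\otimes V$ with the usual tensor product action. The module $\bm{T}'$ is formed in the same way from $m'\in\mathbb{N}$, parameters $\lambda_j'\in\mathbb{C}^*$, $\alpha_j',\beta_j',\gamma_j'\in\mathbb{C}$ with $\alpha_j'\neq0$ or $\beta_j'\neq0$, polynomials $g_j(t_j)\in\mathbb{C}[t_j]$ ($1\leq j\leq m'$), and an irreducible restricted $\mathfrak{L}$-module $V'$. *)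

theory Defs
  imports
    "HOL-Library.FuncSet"
    "HOL-Library.Poly_Mapping"
    "HOL-Computational_Algebra.Polynomial"
    "HOL-Combinatorics.Permutations"
    "HOL-Algebra.Module"
begin

section \<open>Free complex vector spaces\<close>

text \<open>The type \<open>'k \<Rightarrow>\<^sub>0 complex\<close> of finitely supported functions is the vector space
  with basis \<open>Poly_Mapping.single k 1\<close>.\<close>

definition pm_scale :: "complex \<Rightarrow> ('k \<Rightarrow>\<^sub>0 complex) \<Rightarrow> ('k \<Rightarrow>\<^sub>0 complex)" where
  "pm_scale c f = Poly_Mapping.map (\<lambda>a. c * a) f"

lemma lookup_pm_scale [simp]: "Poly_Mapping.lookup (pm_scale c f) k = c * Poly_Mapping.lookup f k"
  by (simp add: pm_scale_def Poly_Mapping.map.rep_eq when_def)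

global_interpretation pm: vector_space pm_scale
  by unfold_locales (auto intro!: poly_mapping_eqI simp: lookup_add algebra_simps)

definition pm_extend :: "('k \<Rightarrow> ('l \<Rightarrow>\<^sub>0 complex)) \<Rightarrow> ('k \<Rightarrow>\<^sub>0 complex) \<Rightarrow> ('l \<Rightarrow>\<^sub>0 complex)" where
  "pm_extend g f = (\<Sum>k\<in>Poly_Mapping.keys f. pm_scale (Poly_Mapping.lookup f k) (g k))"


section \<open>The BMS-Kac-Moody algebra\<close>

datatype bms_gen = Lgen int | Wgen int | Igen int | Jgen int

type_synonym bms = "bms_gen \<Rightarrow>\<^sub>0 complex"

fun gen_bracket :: "bms_gen \<Rightarrow> bms_gen \<Rightarrow> bms" where
  "gen_bracket (Lgen m) (Lgen n) = Poly_Mapping.single (Lgen (m + n)) (of_int (n - m))"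
| "gen_bracket (Lgen m) (Wgen n) = Poly_Mapping.single (Wgen (m + n)) (of_int (n - m))"
| "gen_bracket (Wgen m) (Lgen n) = Poly_Mapping.single (Wgen (m + n)) (of_int (n - m))"
| "gen_bracket (Lgen m) (Igen n) = Poly_Mapping.single (Igen (m + n)) (of_int n)"
| "gen_bracket (Igen m) (Lgen n) = Poly_Mapping.single (Igen (m + n)) (- of_int m)"
| "gen_bracket (Lgen m) (Jgen n) = Poly_Mapping.single (Jgen (m + n)) (of_int n)"
| "gen_bracket (Jgen m) (Lgen n) = Poly_Mapping.single (Jgen (m + n)) (- of_int m)"
| "gen_bracket (Wgen m) (Igen n) = Poly_Mapping.single (Jgen (m + n)) (- of_int n)"
| "gen_bracket (Igen m) (Wgen n) = Poly_Mapping.single (Jgen (m + n)) (of_int m)"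
| "gen_bracket _ _ = 0"

definition bracket :: "bms \<Rightarrow> bms \<Rightarrow> bms" where
  "bracket x y = pm_extend (\<lambda>a. pm_extend (\<lambda>b. gen_bracket a b) y) x"

definition bms_grade :: "int \<Rightarrow> bms set" where
  "bms_grade n = {x. Poly_Mapping.keys x \<subseteq> {Lgen n, Wgen n, Igen n, Jgen n}}"


section \<open>Modules over the algebra\<close>

definition complex_ring :: "complex ring" where
  "complex_ring = \<lparr>carrier = UNIV, mult = (*), one = 1, zero = 0, add = (+)\<rparr>"

text \<open>The fields \<open>mult\<close> and \<open>one\<close> inherited from the library record of modules play no role
  and are left undefined in the concrete modules below.\<close>

record 'v bms_mod = "(complex, 'v) module" +
  act :: "bms \<Rightarrow> 'v \<Rightarrow> 'v"

locale bms_module = Module.module complex_ring V for V :: "'v bms_mod" (structure) +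
  assumes act_closed: "v \<in> carrier V \<Longrightarrow> act V x v \<in> carrier V"
    and act_add_left: "v \<in> carrier V \<Longrightarrow> act V (x + y) v = act V x v \<oplus> act V y v"
    and act_scale_left: "v \<in> carrier V \<Longrightarrow> act V (pm_scale c x) v = c \<odot> act V x v"
    and act_add_right: "\<lbrakk>v \<in> carrier V; w \<in> carrier V\<rbrakk> \<Longrightarrow> act V x (v \<oplus> w) = act V x v \<oplus> act V x w"
    and act_scale_right: "v \<in> carrier V \<Longrightarrow> act V x (c \<odot> v) = c \<odot> act V x v"
    and act_bracket: "v \<in> carrier V \<Longrightarrow>
          act V (bracket x y) v = act V x (act V y v) \<ominus> act V y (act V x v)"

definition bms_submodule :: "'v set \<Rightarrow> 'v bms_mod \<Rightarrow> bool" where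
  "bms_submodule U V \<longleftrightarrow> submodule U complex_ring V \<and> (\<forall>x. \<forall>u\<in>U. act V x u \<in> U)"

definition bms_irreducible :: "'v bms_mod \<Rightarrow> bool" where
  "bms_irreducible V \<longleftrightarrow> carrier V \<noteq> {\<zero>\<^bsub>V\<^esub>} \<and>
     (\<forall>U. bms_submodule U V \<longrightarrow> U = {\<zero>\<^bsub>V\<^esub>} \<or> U = carrier V)"

definition bms_restricted :: "'v bms_mod \<Rightarrow> bool" where
  "bms_restricted V \<longleftrightarrow>
     (\<forall>v\<in>carrier V. \<exists>k::nat. \<forall>n\<ge>int k. \<forall>x\<in>bms_grade n. act V x v = \<zero>\<^bsub>V\<^esub>)"

definition bms_iso :: "'v bms_mod \<Rightarrow> 'w bms_mod \<Rightarrow> bool" where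
  "bms_iso V W \<longleftrightarrow> (\<exists>\<phi>. bij_betw \<phi> (carrier V) (carrier W) \<and>
     (\<forall>u\<in>carrier V. \<forall>v\<in>carrier V. \<phi> (u \<oplus>\<^bsub>V\<^esub> v) = \<phi> u \<oplus>\<^bsub>W\<^esub> \<phi> v) \<and>
     (\<forall>c. \<forall>v\<in>carrier V. \<phi> (c \<odot>\<^bsub>V\<^esub> v) = c \<odot>\<^bsub>W\<^esub> \<phi> v) \<and>
     (\<forall>x. \<forall>v\<in>carrier V. \<phi> (act V x v) = act W x (\<phi> v)))"


section \<open>The modules on polynomials in two variables\<close>

text \<open>A polynomial \<open>f(s,t)\<close> is of type \<open>complex poly poly\<close>: a polynomial in \<open>s\<close> whose
  coefficients are polynomials in \<open>t\<close>. So \<open>[:0, 1:]\<close> is \<open>s\<close>, and \<open>[:p:]\<close> embeds \<open>p(t)\<close>.\<close>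

definition shift_s :: "int \<Rightarrow> complex poly poly \<Rightarrow> complex poly poly" where
  "shift_s n f = pcompose f [:- of_int n, 1:]"

definition partial_t :: "complex poly poly \<Rightarrow> complex poly poly" where
  "partial_t f = map_poly pderiv f"

text \<open>The division is exact, as \<open>t - \<alpha>\<close> divides \<open>h(t) - h(\<alpha>)\<close>.\<close>
definition H_poly :: "complex \<Rightarrow> complex poly \<Rightarrow> complex poly" where
  "H_poly \<alpha> h = (h - [:poly h \<alpha>:]) div [:- \<alpha>, 1:]"

definition h_sub :: "complex \<Rightarrow> complex poly \<Rightarrow> int \<Rightarrow> complex poly" where
  "h_sub \<alpha> h n = of_int n * h - Polynomial.smult (of_int (n * (n - 1)) * \<alpha>) (H_poly \<alpha> h)"

fun Phi_gen_act :: "complex \<Rightarrow> complex \<Rightarrow> complex \<Rightarrow> complex \<Rightarrow> complex poly \<Rightarrow>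
    bms_gen \<Rightarrow> complex poly poly \<Rightarrow> complex poly poly" where
  "Phi_gen_act l \<alpha> \<beta> \<gamma> h (Lgen n) f =
     Polynomial.smult [:l powi n:] (([:0, 1:] + [:h_sub \<alpha> h n:]) * shift_s n f)
     - Polynomial.smult [:of_int n * l powi n:] ([:[:- of_int n * \<alpha>, 1:]:] * partial_t (shift_s n f))"
| "Phi_gen_act l \<alpha> \<beta> \<gamma> h (Wgen n) f =
     Polynomial.smult [:l powi n:] ([:[:- of_int n * \<alpha>, 1:]:] * shift_s n f)"
| "Phi_gen_act l \<alpha> \<beta> \<gamma> h (Igen n) f =
     Polynomial.smult [:l powi n:] ([:[:\<gamma>:] - Polynomial.smult (of_int n * \<beta>) (H_poly \<alpha> h):] * shift_s n f)
     + Polynomial.smult [:of_int n * l powi n * \<beta>:] (partial_t (shift_s n f))"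
| "Phi_gen_act l \<alpha> \<beta> \<gamma> h (Jgen n) f = Polynomial.smult [:l powi n * \<beta>:] (shift_s n f)"

definition Phi :: "complex \<Rightarrow> complex \<Rightarrow> complex \<Rightarrow> complex \<Rightarrow> complex poly \<Rightarrow>
    complex poly poly bms_mod" where
  "Phi l \<alpha> \<beta> \<gamma> h =
     \<lparr>carrier = UNIV, mult = undefined, one = undefined, zero = 0, add = (+),
      smult = (\<lambda>c. Polynomial.smult [:c:]),
      act = (\<lambda>x f. \<Sum>a\<in>Poly_Mapping.keys x.
        Polynomial.smult [:Poly_Mapping.lookup x a:] (Phi_gen_act l \<alpha> \<beta> \<gamma> h a f))\<rparr>"


section \<open>Tensor products\<close>

text \<open>The tensor product of \<open>M i\<close> (\<open>i \<in> A\<close>, with \<open>A\<close> finite) and \<open>V\<close>, as the free vector space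
  on \<open>(\<Prod>i\<in>A. M i) \<times> V\<close> modulo the subspace spanned by the multilinearity relators.
  The factor \<open>V\<close> is separate only because its elements have a different type.\<close>

definition tensor_gens :: "'i set \<Rightarrow> ('i \<Rightarrow> 'a bms_mod) \<Rightarrow> 'v bms_mod \<Rightarrow> (('i \<Rightarrow> 'a) \<times> 'v) set" where
  "tensor_gens A M V = (\<Pi>\<^sub>E i\<in>A. carrier (M i)) \<times> carrier V"

definition tensor_free ::
    "'i set \<Rightarrow> ('i \<Rightarrow> 'a bms_mod) \<Rightarrow> 'v bms_mod \<Rightarrow> (('i \<Rightarrow> 'a) \<times> 'v \<Rightarrow>\<^sub>0 complex) set" where
  "tensor_free A M V = {f. Poly_Mapping.keys f \<subseteq> tensor_gens A M V}"

abbreviation pure :: "('i \<Rightarrow> 'a) \<Rightarrow> 'v \<Rightarrow> (('i \<Rightarrow> 'a) \<times> 'v \<Rightarrow>\<^sub>0 complex)" where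
  "pure u v \<equiv> Poly_Mapping.single (u, v) 1"

definition tensor_relators ::
    "'i set \<Rightarrow> ('i \<Rightarrow> 'a bms_mod) \<Rightarrow> 'v bms_mod \<Rightarrow> (('i \<Rightarrow> 'a) \<times> 'v \<Rightarrow>\<^sub>0 complex) set" where
  "tensor_relators A M V =
     {pure (u(i := a \<oplus>\<^bsub>M i\<^esub> b)) v - pure (u(i := a)) v - pure (u(i := b)) v | u v i a b.
        (u, v) \<in> tensor_gens A M V \<and> i \<in> A \<and> a \<in> carrier (M i) \<and> b \<in> carrier (M i)}
   \<union> {pure (u(i := c \<odot>\<^bsub>M i\<^esub> a)) v - pm_scale c (pure (u(i := a)) v) | u v i c a.
        (u, v) \<in> tensor_gens A M V \<and> i \<in> A \<and> a \<in> carrier (M i)}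
   \<union> {pure u (v \<oplus>\<^bsub>V\<^esub> w) - pure u v - pure u w | u v w.
        (u, v) \<in> tensor_gens A M V \<and> w \<in> carrier V}
   \<union> {pure u (c \<odot>\<^bsub>V\<^esub> v) - pm_scale c (pure u v) | u v c.
        (u, v) \<in> tensor_gens A M V}"

definition tensor_rel ::
    "'i set \<Rightarrow> ('i \<Rightarrow> 'a bms_mod) \<Rightarrow> 'v bms_mod \<Rightarrow> (('i \<Rightarrow> 'a) \<times> 'v \<Rightarrow>\<^sub>0 complex) rel" where
  "tensor_rel A M V = {(f, g). f \<in> tensor_free A M V \<and> g \<in> tensor_free A M V \<and>
     f - g \<in> pm.span (tensor_relators A M V)}"

definition tensor_act :: "'i set \<Rightarrow> ('i \<Rightarrow> 'a bms_mod) \<Rightarrow> 'v bms_mod \<Rightarrow> bms \<Rightarrow>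
    (('i \<Rightarrow> 'a) \<times> 'v \<Rightarrow>\<^sub>0 complex) \<Rightarrow> (('i \<Rightarrow> 'a) \<times> 'v \<Rightarrow>\<^sub>0 complex)" where
  "tensor_act A M V x = pm_extend (\<lambda>(u, v).
     (\<Sum>i\<in>A. pure (u(i := act (M i) x (u i))) v) + pure u (act V x v))"

definition tensor_module :: "'i set \<Rightarrow> ('i \<Rightarrow> 'a bms_mod) \<Rightarrow> 'v bms_mod \<Rightarrow>
    (('i \<Rightarrow> 'a) \<times> 'v \<Rightarrow>\<^sub>0 complex) set bms_mod" where
  "tensor_module A M V =
     \<lparr>carrier = tensor_free A M V // tensor_rel A M V,
      mult = undefined, one = undefined,
      zero = tensor_rel A M V `` {0},
      add = (\<lambda>F G. \<Union>f\<in>F. \<Union>g\<in>G. tensor_rel A M V `` {f + g}),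
      smult = (\<lambda>c F. \<Union>f\<in>F. tensor_rel A M V `` {pm_scale c f}),
      act = (\<lambda>x F. \<Union>f\<in>F. tensor_rel A M V `` {tensor_act A M V x f})\<rparr>"

end

theory Submission
  imports Defs
begin

text \<open>
  For \<open>n\<close> large, \<open>X\<^sub>n\<close> with \<open>X \<in> {L, W, I, J}\<close> kills the restricted factor and acts on a fixed
  vector of the tensor product as \<open>\<Sum>\<^sub>i \<lambda>\<^sub>i\<^sup>n p\<^sub>i(n)\<close>, where the operator \<open>p\<^sub>i(n)\<close> acts in the
  \<open>i\<close>-th slot and depends polynomially on \<open>n\<close>. As the \<open>\<lambda>\<^sub>i\<close> are distinct, exponential
  polynomials being linearly independent, an isomorphism matches the \<open>\<lambda>\<^sub>i\<close> with the \<open>\<lambda>'\<^sub>j\<close>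
  and intertwines the operators of each slot for every \<open>n \<in> \<int>\<close>, hence also the actions on \<open>V\<close>
  and \<open>V'\<close>.

  Now consider the image \<open>P\<close> of \<open>1 \<otimes> v\<close>. In each slot it is killed by the operators
  \<open>f \<mapsto> X\<^sub>n(1) f - X'\<^sub>n f\<close>. If such operators have no common kernel on \<open>\<complex>[s,t]\<close>, linear
  algebra gives a left combination of them equal to the identity, so that \<open>P = 0\<close>. A nonzero common
  kernel, however, forces the parameters to agree, and it then consists of constants. So \<open>P\<close> is
  constant in every slot, i.e. \<open>P = 1 \<otimes> \<psi> v\<close>, and \<open>\<psi>\<close> is the isomorphism \<open>V \<cong> V'\<close>.

  Computations in the tensor product take place in the free vector space on its generators, modulo the
  span \<open>R\<close> of the relators.\<close>

section \<open>Sequences depending polynomially on an integer\<close>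

text \<open>The index n = 0 lies outside the range where V is killed, yet it is decisive: L_0 and
  W_0 multiply a slot by s and by t. An exponential polynomial is determined by its values at large
  n, so the slot operators are intertwined at n = 0 as well, and with them multiplication by every
  polynomial. Only this gives X_n(1) f a meaning on the image of 1 \<otimes> v. The obstacle is that
  P is a class in a quotient, without a basis to expand it in; all that is known is that certain
  operators kill it. So the argument stays with operators of the slot space: a linear map vanishing
  on their common kernel factors through them, and the factorisation is then applied to P. The
  condition \<alpha> \<noteq> 0 or \<beta> \<noteq> 0 guards against nonconstant kernel vectors: for
  \<alpha> = \<beta> = 0, two modules with h' = h + k and all other parameters equal have t^k in the
  common kernel. Surjectivity of \<psi> is not read off from the isomorphism; it comes from
  irreducibility of V'.\<close>

definition theta :: "complex poly \<Rightarrow> complex poly" where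
  "theta q = [:0, 1:] * pderiv q"

lemma coeff_theta_funpow: "coeff ((theta ^^ p) q) d = of_nat d ^ p * coeff q d"
proof (induction p)
  case (Suc p)
  have "coeff (theta r) d = of_nat d * coeff r d" for r
    by (cases d) (simp_all add: theta_def coeff_pCons coeff_pderiv)
  with Suc show ?case by simp
qed simp

text \<open>Monomials are eigenvectors of \<open>theta\<close> with their degree as eigenvalue,
  which produces the weights d^p of a sequence polynomial in d.\<close>

lemma poly_theta_funpow:
  "poly ((theta ^^ p) q) x = (\<Sum>d\<le>degree q. of_nat d ^ p * coeff q d * x ^ d)"
proof -
  have "poly ((theta ^^ p) q) x = (\<Sum>d\<le>degree q. coeff ((theta ^^ p) q) d * x ^ d)"
    unfolding poly_altdef
  proof (rule sum.mono_neutral_left)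
    have "degree ((theta ^^ p) q) \<le> degree q"
      by (rule degree_le) (simp add: coeff_theta_funpow coeff_eq_0)
    then show "{..degree ((theta ^^ p) q)} \<subseteq> {..degree q}" by simp
  qed (auto simp: coeff_eq_0)
  then show ?thesis by (simp add: coeff_theta_funpow)
qed

text \<open>Each \<open>theta\<close> lowers the order of the zero at x by at most one, so nothing
  survives before the r-th application; the r-th leaves only the term in which every derivative has
  hit a factor X - x.\<close>

lemma poly_theta_funpow_root_power:
  "p \<le> r \<Longrightarrow> poly ((theta ^^ p) ([:- x, 1:] ^ r * q)) x
     = (if p = r then fact r * x ^ r * poly q x else 0)"
proof (induction r arbitrary: p q)
  case (Suc r)
  show ?case
  proof (cases p)
    case 0
    then show ?thesis by simp
  next
    case (Suc p')
    \<comment> \<open>Product rule: one factor X - x is taken off, and the cofactor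
      \<open>q'\<close> has the value (r + 1) x q(x) at x, which builds up the factorial and the
      power of x.\<close>
    define q' where "q' = [:0, 1:] * (of_nat (Suc r) * q + [:- x, 1:] * pderiv q)"
    have "theta ([:- x, 1:] ^ Suc r * q) = [:- x, 1:] ^ r * q'"
      unfolding theta_def q'_def pderiv_mult pderiv_power_Suc
      by (simp add: pderiv_pCons smult_add_left of_nat_poly algebra_simps)
    then have "(theta ^^ p) ([:- x, 1:] ^ Suc r * q) = (theta ^^ p') ([:- x, 1:] ^ r * q')"
      by (simp add: Suc funpow_Suc_right del: funpow.simps power_Suc)
    then show ?thesis
      using Suc.IH[of p' q'] Suc Suc.prems by (simp add: q'_def algebra_simps)
  qed
qed simp

text \<open>Needed for two spaces: \<open>cscale\<close> for the polynomials in one slot and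
  \<open>pm_scale\<close> for the free space above the tensor product.\<close>

locale complex_space = vector_space scale
  for scale :: "complex \<Rightarrow> 'b \<Rightarrow> 'b::ab_group_add" (infixr "*s" 75)
begin

text \<open>Congruence modulo R replaces equality because identities in a tensor product hold only
  up to relators; R = {0} gives genuine polynomial sequences.\<close>

definition poly_seq :: "'b set \<Rightarrow> (int \<Rightarrow> 'b) \<Rightarrow> bool" where
  "poly_seq R a \<longleftrightarrow> (\<exists>N c. \<forall>n. a n - (\<Sum>p<N. of_int n ^ p *s c p) \<in> R)"

lemma poly_seqI: "(\<And>n. a n - (\<Sum>p<N. of_int n ^ p *s c p) \<in> R) \<Longrightarrow> poly_seq R a"
  unfolding poly_seq_def by blast

text \<open>Padding with zero coefficients lets several sequences share one length.\<close>

lemma poly_seqE: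
  assumes "poly_seq R a"
  obtains N c where "\<And>p. p \<ge> N \<Longrightarrow> c p = 0"
    and "\<And>M n. N \<le> M \<Longrightarrow> a n - (\<Sum>p<M. of_int n ^ p *s c p) \<in> R"
proof -
  obtain N c where c: "\<And>n. a n - (\<Sum>p<N. of_int n ^ p *s c p) \<in> R"
    using assms unfolding poly_seq_def by blast
  define d where "d p = (if p < N then c p else 0)" for p
  have "(\<Sum>p<M. of_int n ^ p *s d p) = (\<Sum>p<N. of_int n ^ p *s c p)" if "N \<le> M" for M n
    by (rule sum.mono_neutral_cong_right) (use that in \<open>auto simp: d_def\<close>)
  with c show ?thesis by (intro that[of N d]) (auto simp: d_def)
qed

lemma poly_seq_const: "subspace R \<Longrightarrow> poly_seq R (\<lambda>_. x)"
  unfolding poly_seq_def by (rule exI[of _ 1], rule exI[of _ "\<lambda>_. x"]) (simp add: subspace_0)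

lemma poly_seq_add:
  assumes R: "subspace R" and "poly_seq R a" "poly_seq R b"
  shows "poly_seq R (\<lambda>n. a n + b n)"
proof -
  from assms(2) obtain N c where
    c: "\<And>M n. N \<le> M \<Longrightarrow> a n - (\<Sum>p<M. of_int n ^ p *s c p) \<in> R" by (rule poly_seqE) blast
  from assms(3) obtain N' c' where
    c': "\<And>M n. N' \<le> M \<Longrightarrow> b n - (\<Sum>p<M. of_int n ^ p *s c' p) \<in> R" by (rule poly_seqE) blast
  have "a n + b n - (\<Sum>p<max N N'. of_int n ^ p *s (c p + c' p)) \<in> R" for n
    using subspace_add[OF R c[of "max N N'" n] c'[of "max N N'" n]]
    by (simp add: scale_right_distrib sum.distrib algebra_simps)
  then show ?thesis by (rule poly_seqI)
qed

text \<open>The map \<open>g\<close> is linear only modulo S: the intended one sends a polynomial a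
  to the generator \<open>pure (u(i := a)) v\<close>, which is not additive in the free
  space.\<close>

lemma poly_seq_linear_mod:
  assumes R: "Modules.module.subspace s' R"
    and S: "subspace S"
    and g: "vector_space s'"
    and add: "\<And>x y. g (x + y) - (g x + g y) \<in> S"
    and scale: "\<And>c x. g (s' c x) - c *s g x \<in> S"
    and mem: "\<And>x. x \<in> R \<Longrightarrow> g x \<in> S"
    and a: "complex_space.poly_seq s' R a"
  shows "poly_seq S (\<lambda>n. g (a n))"
proof -
  interpret v: vector_space s' by fact
  interpret v: complex_space s' by unfold_locales
  obtain N c where c: "\<And>n. a n - (\<Sum>p<N. s' (of_int n ^ p) (c p)) \<in> R"
    using a unfolding v.poly_seq_def by blast
  have g0: "g 0 \<in> S"
    using scale[of 0 0] by simp
  have sum: "g (\<Sum>p<M. s' (f p) (c p)) - (\<Sum>p<M. f p *s g (c p)) \<in> S" for M f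
  proof (induction M)
    case (Suc M)
    show ?case
      using subspace_add[OF S subspace_add[OF S add[of "\<Sum>p<M. s' (f p) (c p)" "s' (f M) (c M)"] Suc]
          scale[of "f M" "c M"]]
      by (simp add: algebra_simps)
  qed (simp add: g0)
  have "g (a n) - (\<Sum>p<N. of_int n ^ p *s g (c p)) \<in> S" for n
    using subspace_add[OF S subspace_add[OF S
        add[of "a n - (\<Sum>p<N. s' (of_int n ^ p) (c p))" "\<Sum>p<N. s' (of_int n ^ p) (c p)"]
        mem[OF c[of n]]] sum[where f = "\<lambda>p. of_int n ^ p" and M = N]]
    by (simp add: algebra_simps)
  then show ?thesis by (rule poly_seqI)
qed

lemma poly_seq_scale:
  assumes "subspace R" "poly_seq R a"
  shows "poly_seq R (\<lambda>n. c *s a n)"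
  by (rule poly_seq_linear_mod[where s' = scale and R = R and g = "scale c"])
     (use assms in \<open>auto simp: scale_right_distrib subspace_0 mult.commute vector_space_axioms intro: subspace_scale\<close>)

lemma poly_seq_diff:
  assumes "subspace R" "poly_seq R a" "poly_seq R b"
  shows "poly_seq R (\<lambda>n. a n - b n)"
  using poly_seq_add[OF assms(1,2) poly_seq_scale[OF assms(1,3), of "-1"]] by simp

lemma poly_seq_sum:
  assumes "subspace R" "\<And>i. i \<in> I \<Longrightarrow> poly_seq R (a i)"
  shows "poly_seq R (\<lambda>n. \<Sum>i\<in>I. a i n)"
  using assms(2)
  by (induction I rule: infinite_finite_induct)
     (auto intro: poly_seq_const[OF assms(1)] poly_seq_add[OF assms(1)])

lemma poly_seq_times_index:
  assumes R: "subspace R" and a: "poly_seq R a"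
  shows "poly_seq R (\<lambda>n. of_int n *s a n)"
proof -
  obtain N c where c: "\<And>n. a n - (\<Sum>p<N. of_int n ^ p *s c p) \<in> R"
    using a unfolding poly_seq_def by blast
  define d where "d p = (case p of 0 \<Rightarrow> 0 | Suc p \<Rightarrow> c p)" for p
  have "of_int n *s a n - (\<Sum>p<Suc N. of_int n ^ p *s d p) \<in> R" for n
    using subspace_scale[OF R c[of n], of "of_int n"]
    by (simp add: d_def sum.lessThan_Suc_shift scale_right_diff_distrib scale_sum_right
        del: sum.lessThan_Suc)
  then show ?thesis by (rule poly_seqI)
qed

text \<open>A combination of finitely many shifts of the sequence is a combination of the coefficients
  \<open>c \<mu> p\<close> with weights \<open>\<theta>\<^sup>p q (\<mu>)\<close>, where \<open>\<theta> = x d/dx\<close>. Prescribing zeros of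
  \<open>q\<close> isolates the coefficients one at a time, from the top one downwards.\<close>

lemma exp_poly_coeff_mem:
  fixes S :: "complex set"
  assumes R: "subspace R" and S: "finite S" "0 \<notin> S"
    and mem: "\<And>n. n \<ge> k \<Longrightarrow> (\<Sum>\<mu>\<in>S. \<mu> ^ n *s (\<Sum>p<N. of_nat n ^ p *s c \<mu> p)) \<in> R"
    and \<mu>: "\<mu> \<in> S"
  shows "r < N \<Longrightarrow> c \<mu> r \<in> R"
proof (induction "N - r" arbitrary: r rule: less_induct)
  case less
  have IH: "c \<mu> p \<in> R" if "r < p" "p < N" for p
    using less(1)[of p] that by simp
  define Q where "Q = (\<Prod>\<nu>\<in>S - {\<mu>}. [:- \<nu>, 1:] ^ N)"
  \<comment> \<open>The factor X^k silences the indices below k, where nothing is assumed;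
    \<open>Q\<close> kills the weights at the other bases; the power r kills those at \<mu> with p <
    r. The weights with p > r meet coefficients that the induction already placed in R.\<close>
  define q where "q = monom 1 k * Q * [:- \<mu>, 1:] ^ r"
  define w where "w p \<nu> = poly ((theta ^^ p) q) \<nu>" for p \<nu>
  have w_other: "w p \<nu> = 0" if "\<nu> \<in> S - {\<mu>}" "p < N" for p \<nu>
  proof -
    have "q = [:- \<nu>, 1:] ^ N * (monom 1 k * (\<Prod>\<nu>\<in>S - {\<mu>} - {\<nu>}. [:- \<nu>, 1:] ^ N) * [:- \<mu>, 1:] ^ r)"
      using S that by (simp add: q_def Q_def prod.remove[of "S - {\<mu>}" \<nu>] mult_ac)
    then show ?thesis
      using poly_theta_funpow_root_power[of p N \<nu>] that by (simp add: w_def)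
  qed
  have w_\<mu>: "w p \<mu> = (if p = r then fact r * \<mu> ^ r * poly (monom 1 k * Q) \<mu> else 0)" if "p \<le> r" for p
    using poly_theta_funpow_root_power[OF that, of \<mu> "monom 1 k * Q"] by (simp add: w_def q_def mult_ac)
  have "\<mu> \<noteq> 0" using \<mu> S by auto
  moreover have "poly Q \<mu> \<noteq> 0"
    using S by (auto simp: Q_def poly_prod)
  \<comment> \<open>Here 0 \<notin> S matters: this weight contains \<mu>^r and \<mu>^k as
    factors.\<close>
  ultimately have nz: "w r \<mu> \<noteq> 0"
    by (simp add: w_\<mu> poly_monom)
  have "(\<Sum>\<nu>\<in>S. \<Sum>p<N. w p \<nu> *s c \<nu> p)
      = (\<Sum>\<nu>\<in>S. \<Sum>p<N. \<Sum>d\<le>degree q. (of_nat d ^ p * coeff q d * \<nu> ^ d) *s c \<nu> p)"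
    by (simp add: w_def poly_theta_funpow scale_sum_left)
  also have "\<dots> = (\<Sum>\<nu>\<in>S. \<Sum>d\<le>degree q. \<Sum>p<N. (of_nat d ^ p * coeff q d * \<nu> ^ d) *s c \<nu> p)"
    by (rule sum.cong[OF refl]) (rule sum.swap)
  also have "\<dots> = (\<Sum>d\<le>degree q. \<Sum>\<nu>\<in>S. \<Sum>p<N. (of_nat d ^ p * coeff q d * \<nu> ^ d) *s c \<nu> p)"
    by (rule sum.swap)
  also have "\<dots> = (\<Sum>d\<le>degree q. coeff q d *s (\<Sum>\<nu>\<in>S. \<nu> ^ d *s (\<Sum>p<N. of_nat d ^ p *s c \<nu> p)))"
    by (simp add: scale_sum_right mult_ac)
  also have "\<dots> \<in> R"
  proof (rule subspace_sum[OF R])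
    fix d
    show "coeff q d *s (\<Sum>\<nu>\<in>S. \<nu> ^ d *s (\<Sum>p<N. of_nat d ^ p *s c \<nu> p)) \<in> R"
    proof (cases "d \<ge> k")
      case True
      then show ?thesis by (intro subspace_scale[OF R] mem)
    next
      case False
      then have "coeff q d = 0"
        by (simp add: q_def mult.assoc coeff_monom_mult)
      then show ?thesis by (simp add: subspace_0[OF R])
    qed
  qed
  also have "(\<Sum>\<nu>\<in>S. \<Sum>p<N. w p \<nu> *s c \<nu> p) = (\<Sum>p<N. w p \<mu> *s c \<mu> p)"
    using S \<mu> by (subst sum.remove[of S \<mu>]) (auto intro!: sum.neutral simp: w_other)
  also have "\<dots> = w r \<mu> *s c \<mu> r + (\<Sum>p\<in>{..<N} - {r}. w p \<mu> *s c \<mu> p)"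
    using less.prems by (subst sum.remove[of _ r]) auto
  finally have tot: "w r \<mu> *s c \<mu> r + (\<Sum>p\<in>{..<N} - {r}. w p \<mu> *s c \<mu> p) \<in> R" .
  have "(\<Sum>p\<in>{..<N} - {r}. w p \<mu> *s c \<mu> p) \<in> R"
  proof (rule subspace_sum[OF R])
    fix p assume p: "p \<in> {..<N} - {r}"
    show "w p \<mu> *s c \<mu> p \<in> R"
    proof (cases "p < r")
      case True
      then show ?thesis using w_\<mu>[of p] by (simp add: subspace_0[OF R])
    next
      case False
      with p show ?thesis by (intro subspace_scale[OF R] IH) auto
    qed
  qed
  from subspace_diff[OF R tot this] have "w r \<mu> *s c \<mu> r \<in> R" by simp
  from subspace_scale[OF R this, of "inverse (w r \<mu>)"] nz show ?case by simp
qed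

text \<open>Large n determine the coefficients modulo R, and the coefficients determine the sequence
  at every integer. This carries information from n \<ge> k to n = 0 and to negative n.\<close>

lemma exp_poly_seq_mem:
  fixes S :: "complex set"
  assumes R: "subspace R" and S: "finite S" "0 \<notin> S"
    and a: "\<And>\<mu>. \<mu> \<in> S \<Longrightarrow> poly_seq R (a \<mu>)"
    and mem: "\<And>n. n \<ge> k \<Longrightarrow> (\<Sum>\<mu>\<in>S. \<mu> ^ n *s a \<mu> (int n)) \<in> R"
    and \<mu>: "\<mu> \<in> S"
  shows "a \<mu> n \<in> R"
proof -
  have "\<exists>N c. \<forall>M\<ge>N. \<forall>n. a \<mu> n - (\<Sum>p<M. of_int n ^ p *s c p) \<in> R" if "\<mu> \<in> S" for \<mu>
    using a[OF that] by (rule poly_seqE) blast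
  then obtain N c where
    c: "\<And>\<mu> M n. \<mu> \<in> S \<Longrightarrow> N \<mu> \<le> M \<Longrightarrow> a \<mu> n - (\<Sum>p<M. of_int n ^ p *s c \<mu> p) \<in> R"
    by metis
  define M where "M = Max (N ` S)"
  have c: "a \<mu> n - (\<Sum>p<M. of_int n ^ p *s c \<mu> p) \<in> R" if "\<mu> \<in> S" for \<mu> n
    using c[OF that, of M n] that S by (simp add: M_def)
  have "(\<Sum>\<mu>\<in>S. \<mu> ^ n *s (\<Sum>p<M. of_nat n ^ p *s c \<mu> p)) \<in> R" if "n \<ge> k" for n
  proof -
    have "(\<Sum>\<mu>\<in>S. \<mu> ^ n *s (a \<mu> (int n) - (\<Sum>p<M. of_nat n ^ p *s c \<mu> p))) \<in> R"
      using c[where n = "int n"] by (intro subspace_sum[OF R] subspace_scale[OF R]) simp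
    from subspace_diff[OF R mem[OF that] this] show ?thesis
      by (simp add: scale_right_diff_distrib sum_subtractf)
  qed
  from exp_poly_coeff_mem[OF R S this \<mu>] have "c \<mu> r \<in> R" if "r < M" for r
    using that by blast
  then have "(\<Sum>p<M. of_int n ^ p *s c \<mu> p) \<in> R"
    by (intro subspace_sum[OF R] subspace_scale[OF R]) auto
  from subspace_add[OF R c[OF \<mu>, of n] this] show ?thesis by simp
qed

end

section \<open>Operators annihilating a vector\<close>

context complex_space
begin

lemma linear_zero: "Vector_Spaces.linear scale scale A \<Longrightarrow> A 0 = 0"
  unfolding Vector_Spaces.linear_iff by (metis scale_zero_left)

lemma linear_module_hom: "Vector_Spaces.linear scale scale A \<Longrightarrow> module_hom scale scale A"
  by (simp add: Vector_Spaces.linear_def)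

text \<open>Choose preimages in U of a basis of A(U), prescribe \<open>G\<close> on that basis by B,
  and extend. The kernel condition makes B f independent of the preimage. \<open>G\<close> is
  defined on the whole space so that it is again an operator of the kind that \<open>\<rho>\<close>
  represents below.\<close>

lemma linear_factor_on:
  assumes A: "Vector_Spaces.linear scale scale A" and B: "Vector_Spaces.linear scale scale B"
    and U: "subspace U" and ker: "\<And>f. f \<in> U \<Longrightarrow> A f = 0 \<Longrightarrow> B f = 0"
  shows "\<exists>G. Vector_Spaces.linear scale scale G \<and> (\<forall>f\<in>U. G (A f) = B f)"
proof -
  interpret A: Vector_Spaces.linear scale scale A by fact
  interpret B: Vector_Spaces.linear scale scale B by fact
  interpret vector_space_pair scale scale ..
  obtain D where D: "D \<subseteq> A ` U" "independent D" "A ` U \<subseteq> span D"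
    using maximal_independent_subset[of "A ` U"] by blast
  from D(1) have "\<forall>d\<in>D. \<exists>w. w \<in> U \<and> A w = d" by auto
  from bchoice[OF this] obtain u where u: "\<forall>d\<in>D. u d \<in> U \<and> A (u d) = d" ..
  have "\<exists>G. Vector_Spaces.linear scale scale G \<and> (\<forall>d\<in>D. G d = B (u d))"
    by (rule linear_independent_extend[OF D(2)])
  then obtain G where G: "Vector_Spaces.linear scale scale G" "\<forall>d\<in>D. G d = B (u d)"
    by (elim exE conjE that)
  interpret G: Vector_Spaces.linear scale scale G by fact
  define S where "S = {y. \<exists>f\<in>U. A f = y \<and> G y = B f}"
  have "subspace S"
  proof (rule subspaceI)
    show "0 \<in> S" using subspace_0[OF U] by (force simp: S_def G.zero A.zero B.zero)
    show "x + y \<in> S" if "x \<in> S" "y \<in> S" for x y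
      using that subspace_add[OF U] by (force simp: S_def G.add A.add B.add)
    show "c *s x \<in> S" if "x \<in> S" for c x
      using that subspace_scale[OF U] by (force simp: S_def G.scale A.scale B.scale)
  qed
  moreover have "D \<subseteq> S" using u G(2) by (force simp: S_def)
  ultimately have S: "A ` U \<subseteq> S" using span_minimal D(3) by blast
  have "G (A f) = B f" if f: "f \<in> U" for f
  proof -
    from S f obtain f' where f': "f' \<in> U" "A f' = A f" "G (A f) = B f'"
      by (auto simp: S_def)
    have "B (f - f') = 0"
      using f f' by (intro ker subspace_diff[OF U]) (simp_all add: A.diff)
    with f' show ?thesis by (simp add: B.diff)
  qed
  with G(1) show ?thesis by blast
qed

text \<open>If \<open>\<rho>\<close> represents endomorphisms of the space on another space modulo \<open>R\<close>, the
  operators that annihilate \<open>P\<close> modulo \<open>R\<close> are controlled by their common kernel: a linear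
  map vanishing on that kernel is a left combination of them.\<close>

lemma annihilator_kernel:
  fixes \<rho> :: "('b \<Rightarrow> 'b) \<Rightarrow> 'c \<Rightarrow> 'c::ab_group_add"
  assumes comp: "\<And>A B. \<rho> (A \<circ> B) P = \<rho> A (\<rho> B P)"
    and add: "\<And>A B. \<rho> (\<lambda>x. A x + B x) P - (\<rho> A P + \<rho> B P) \<in> R"
    and zero: "\<rho> (\<lambda>_. 0) P \<in> R"
    and pres: "\<And>A x. Vector_Spaces.linear scale scale A \<Longrightarrow> x \<in> R \<Longrightarrow> \<rho> A x \<in> R"
    and R: "\<And>x y. x \<in> R \<Longrightarrow> y \<in> R \<Longrightarrow> x + y \<in> R"
    and lin: "\<And>A. A \<in> set As \<Longrightarrow> Vector_Spaces.linear scale scale A"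
    and ann: "\<And>A. A \<in> set As \<Longrightarrow> \<rho> A P \<in> R"
    and B: "Vector_Spaces.linear scale scale B"
    and ker: "\<And>f. (\<And>A. A \<in> set As \<Longrightarrow> A f = 0) \<Longrightarrow> B f = 0"
  shows "\<rho> B P \<in> R"
  using lin ann B ker
proof (induction As arbitrary: B)
  case Nil
  then have "B = (\<lambda>_. 0)" by auto
  with zero show ?case by simp
next
  case (Cons A As)
  define U where "U = {f. \<forall>A\<in>set As. A f = 0}"
  have lin: "Vector_Spaces.linear scale scale A'" if "A' \<in> set (A # As)" for A'
    using that Cons.prems(1) by blast
  note A = lin[of A, simplified]
  have U: "subspace U"
    unfolding U_def
    using lin by (intro subspaceI) (auto simp: linear_zero module_hom.add[OF linear_module_hom] module_hom.scale[OF linear_module_hom])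
  have ker: "B f = 0" if "f \<in> U" "A f = 0" for f
    using that Cons.prems(4)[of f] by (auto simp: U_def)
  have "\<exists>G. Vector_Spaces.linear scale scale G \<and> (\<forall>f\<in>U. G (A f) = B f)"
    by (rule linear_factor_on[OF A Cons.prems(3) U]) (rule ker)
  then obtain G where G: "Vector_Spaces.linear scale scale G" "\<forall>f\<in>U. G (A f) = B f"
    by (elim exE conjE that)
  \<comment> \<open>On the common kernel of the remaining operators \<open>G \<circ> A\<close>
    already equals B, so the difference vanishes there and falls under the induction hypothesis for
    the shorter list.\<close>
  define B' where "B' f = B f - G (A f)" for f
  have "Vector_Spaces.linear scale scale B'"
    using Cons.prems(3) A G(1) unfolding B'_def Vector_Spaces.linear_iff
    by (simp add: algebra_simps scale_right_diff_distrib)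
  then have "\<rho> B' P \<in> R"
  proof (rule Cons.IH[rotated 2])
    show "B' f = 0" if "\<And>A. A \<in> set As \<Longrightarrow> A f = 0" for f
      using G(2) that by (simp add: B'_def U_def)
  qed (simp_all add: Cons.prems(1,2))
  moreover have "\<rho> (G \<circ> A) P \<in> R"
    unfolding comp using Cons.prems(2) by (intro pres[OF G(1)]) simp
  moreover have "B = (\<lambda>f. B' f + (G \<circ> A) f)"
    by (simp add: B'_def)
  ultimately show ?case
    using R[OF add[of B' "G \<circ> A"] R[of "\<rho> B' P" "\<rho> (G \<circ> A) P"]] by simp
qed

end

global_interpretation pmc: complex_space pm_scale ..

section \<open>The operators on polynomials in two variables\<close>

text \<open>Complex scalars: on this type \<open>Polynomial.smult\<close> itself takes scalars from
  \<complex>[t].\<close>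

definition cscale :: "complex \<Rightarrow> complex poly poly \<Rightarrow> complex poly poly" where
  "cscale c f = Polynomial.smult [:c:] f"

lemma poly2_eqI: "(\<And>i j. coeff (coeff f i) j = coeff (coeff g i) j) \<Longrightarrow> f = g"
  by (simp add: poly_eqI)

lemma coeff_cscale [simp]: "coeff (coeff (cscale c f) i) j = c * coeff (coeff f i) j"
  by (simp add: cscale_def)

global_interpretation cs: vector_space cscale
  by unfold_locales (auto intro!: poly2_eqI simp: algebra_simps)

global_interpretation csc: complex_space cscale ..

abbreviation clinear :: "(complex poly poly \<Rightarrow> complex poly poly) \<Rightarrow> bool" where
  "clinear \<equiv> Vector_Spaces.linear cscale cscale"

lemma clinearI:
  "(\<And>f g. A (f + g) = A f + A g) \<Longrightarrow> (\<And>c f. A (cscale c f) = cscale c (A f)) \<Longrightarrow> clinear A"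
  by (simp add: Vector_Spaces.linear_iff cs.vector_space_axioms)

lemma cscale_mult: "cscale c f * g = cscale c (f * g)" "f * cscale c g = cscale c (f * g)"
  by (simp_all add: cscale_def)

text \<open>These rules turn identities between operators into identities in a commutative ring.\<close>

lemma const_poly_ring:
  fixes a b :: "'a::comm_ring_1"
  shows "Polynomial.smult a p = [:a:] * p"
  "[:a + b:] = [:a:] + [:b:]"
  "[:a - b:] = [:a:] - [:b:]"
  "[:- a:] = - [:a:]"
  "[:a * b:] = [:a:] * [:b:]"
  "[:of_int n:] = of_int n"
  "[:1:] = 1"
  "[:- a * b, 1:] = [:0, 1:] - [:a:] * [:b:]"
  "pCons (- a * b) 1 = [:0, 1:] - [:a:] * [:b:]"
  by (simp_all add: of_int_poly one_pCons)

lemma shift_s_simps: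
  "shift_s n (f + g) = shift_s n f + shift_s n g"
  "shift_s n (f * g) = shift_s n f * shift_s n g"
  "shift_s n (cscale c f) = cscale c (shift_s n f)"
  "shift_s n [:p:] = [:p:]"
  "shift_s n 1 = 1"
  "shift_s 0 f = f"
  by (simp_all add: shift_s_def cscale_def pcompose_add pcompose_mult pcompose_smult
      pcompose_pCons pcompose_1 pcompose_idR)

text \<open>A Horner step in which n occurs only as a scalar, so that polynomial dependence of the
  shift on n follows by induction on f.\<close>

lemma shift_s_pCons: "shift_s n (pCons a f) = [:a:] + ([:0, 1:] * shift_s n f - cscale (of_int n) (shift_s n f))"
proof -
  have "[:- of_int n, 1:] = [:0, 1:] - [:[:complex_of_int n:]:]" by (simp add: of_int_poly)
  then show ?thesis
    unfolding shift_s_def pcompose_pCons cscale_def by (simp only: left_diff_distrib) simp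
qed

lemma partial_t_simps:
  "partial_t (f + g) = partial_t f + partial_t g"
  "partial_t (cscale c f) = cscale c (partial_t f)"
  "partial_t [:p:] = [:pderiv p:]"
  "partial_t 1 = 0"
  by (auto intro!: poly_eqI
      simp: partial_t_def cscale_def coeff_map_poly pderiv_add pderiv_smult coeff_pCons pderiv_1 coeff_1
      split: nat.splits)

lemma Phi_gen_act_cscale:
  "Phi_gen_act l \<alpha> \<beta> \<gamma> h (Lgen n) f =
     cscale (l powi n) (([:0, 1:] + [:h_sub \<alpha> h n:]) * shift_s n f)
     - cscale (of_int n * l powi n) ([:[:- of_int n * \<alpha>, 1:]:] * partial_t (shift_s n f))"
  "Phi_gen_act l \<alpha> \<beta> \<gamma> h (Wgen n) f =
     cscale (l powi n) ([:[:- of_int n * \<alpha>, 1:]:] * shift_s n f)"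
  "Phi_gen_act l \<alpha> \<beta> \<gamma> h (Igen n) f =
     cscale (l powi n) ([:[:\<gamma>:] - Polynomial.smult (of_int n * \<beta>) (H_poly \<alpha> h):] * shift_s n f)
     + cscale (of_int n * l powi n * \<beta>) (partial_t (shift_s n f))"
  "Phi_gen_act l \<alpha> \<beta> \<gamma> h (Jgen n) f = cscale (l powi n * \<beta>) (shift_s n f)"
  by (simp_all add: cscale_def)

lemma clinear_Phi_gen_act: "clinear (Phi_gen_act l \<alpha> \<beta> \<gamma> h a)"
proof (rule clinearI)
  show "Phi_gen_act l \<alpha> \<beta> \<gamma> h a (f + g) = Phi_gen_act l \<alpha> \<beta> \<gamma> h a f + Phi_gen_act l \<alpha> \<beta> \<gamma> h a g" for f g
    by (cases a) (simp_all only: Phi_gen_act_cscale shift_s_simps partial_t_simps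
        cs.scale_right_distrib distrib_left add_diff_add add.assoc add.left_commute add.commute)
  show "Phi_gen_act l \<alpha> \<beta> \<gamma> h a (cscale c f) = cscale c (Phi_gen_act l \<alpha> \<beta> \<gamma> h a f)" for c f
    by (cases a) (simp_all only: Phi_gen_act_cscale shift_s_simps partial_t_simps cscale_mult
        cs.scale_right_distrib cs.scale_right_diff_distrib cs.scale_scale mult_ac)
qed

text \<open>The four families as functions of the index, so that n can vary while the kind of
  generator stays fixed.\<close>

definition gen_kinds :: "(int \<Rightarrow> bms_gen) set" where
  "gen_kinds = {Lgen, Wgen, Igen, Jgen}"

text \<open>Isolates the exponential part of the dependence on n; the operators with l = 1 are the
  polynomial part.\<close>

lemma Phi_gen_act_powi:
  "K \<in> gen_kinds \<Longrightarrow>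
     Phi_gen_act l \<alpha> \<beta> \<gamma> h (K n) f = cscale (l powi n) (Phi_gen_act 1 \<alpha> \<beta> \<gamma> h (K n) f)"
  unfolding gen_kinds_def
  by (auto simp only: Phi_gen_act_cscale power_int_1_left mult_1 mult_1_right cs.scale_scale mult_ac
      cs.scale_right_distrib cs.scale_right_diff_distrib insert_iff empty_iff)

section \<open>Polynomial dependence of the operators on n\<close>

lemma subspace_cs_0: "cs.subspace {0}"
  by (rule cs.subspace_single_0)

lemma poly_seq_clinear:
  assumes "clinear A" "csc.poly_seq {0} a"
  shows "csc.poly_seq {0} (\<lambda>n. A (a n))"
  by (rule csc.poly_seq_linear_mod[where R = "{0}" and s' = cscale and g = A])
     (use assms in \<open>auto simp: Vector_Spaces.linear_iff subspace_cs_0 cs.vector_space_axioms csc.linear_zero\<close>)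

lemma clinear_mult: "clinear ((*) q)"
  by (rule clinearI) (simp_all add: distrib_left cscale_mult)

lemma clinear_partial_t: "clinear partial_t"
  by (rule clinearI) (simp_all add: partial_t_simps)

lemma clinear_cscale: "clinear (cscale c)"
  by (rule clinearI) (simp_all add: cs.scale_right_distrib mult.commute)

lemma poly_seq_shift_s: "csc.poly_seq {0} (\<lambda>n. shift_s n f)"
proof (induction f)
  case 0
  show ?case by (simp add: shift_s_def csc.poly_seq_const subspace_cs_0)
next
  case (pCons a f)
  show ?case
    unfolding shift_s_pCons
    by (intro csc.poly_seq_add csc.poly_seq_diff csc.poly_seq_const csc.poly_seq_times_index
        poly_seq_clinear[OF clinear_mult] pCons.IH subspace_cs_0)
qed

text \<open>Each action is assembled from \<open>shift_s n f\<close> by linear maps independent of n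
  and by multiplications with n, all of which preserve polynomial sequences.\<close>

lemma poly_seq_Phi_gen_act:
  assumes "K \<in> gen_kinds"
  shows "csc.poly_seq {0} (\<lambda>n. Phi_gen_act 1 \<alpha> \<beta> \<gamma> h (K n) f)"
proof -
  define a where "a n = shift_s n f" for n
  have L: "Phi_gen_act 1 \<alpha> \<beta> \<gamma> h (Lgen n) f = [:0, 1:] * a n + cscale (of_int n) ([:h:] * a n)
      - (cscale (of_int n) (cscale (of_int n) ([:Polynomial.smult \<alpha> (H_poly \<alpha> h):] * a n))
         - cscale (of_int n) ([:Polynomial.smult \<alpha> (H_poly \<alpha> h):] * a n))
      - (cscale (of_int n) ([:[:0, 1:]:] * partial_t (a n))
         - cscale (of_int n) (cscale (of_int n) (cscale \<alpha> (partial_t (a n)))))" for n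
    by (simp only: Phi_gen_act.simps a_def cscale_def h_sub_def const_poly_ring power_int_1_left of_int_mult of_int_diff of_int_1 mult_1_left mult_1_right)
       (simp only: algebra_simps mult_1_left)
  have W: "Phi_gen_act 1 \<alpha> \<beta> \<gamma> h (Wgen n) f = [:[:0, 1:]:] * a n - cscale (of_int n) (cscale \<alpha> (a n))" for n
    by (simp only: Phi_gen_act.simps a_def cscale_def const_poly_ring power_int_1_left mult_1_left mult_1_right)
       (simp only: algebra_simps)
  have I: "Phi_gen_act 1 \<alpha> \<beta> \<gamma> h (Igen n) f = cscale \<gamma> (a n)
      - cscale (of_int n) ([:Polynomial.smult \<beta> (H_poly \<alpha> h):] * a n)
      + cscale (of_int n) (cscale \<beta> (partial_t (a n)))" for n
    by (simp only: Phi_gen_act.simps a_def cscale_def const_poly_ring power_int_1_left mult_1_left mult_1_right)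
       (simp only: algebra_simps)
  have J: "Phi_gen_act 1 \<alpha> \<beta> \<gamma> h (Jgen n) f = cscale \<beta> (a n)" for n
    by (simp add: a_def cscale_def)
  have a: "csc.poly_seq {0} a" unfolding a_def by (rule poly_seq_shift_s)
  consider "K = Lgen" | "K = Wgen" | "K = Igen" | "K = Jgen"
    using assms by (auto simp: gen_kinds_def)
  then show ?thesis
    by cases (simp_all only: L W I J, (intro csc.poly_seq_add csc.poly_seq_diff csc.poly_seq_times_index
        poly_seq_clinear[OF clinear_mult] poly_seq_clinear[OF clinear_cscale]
        poly_seq_clinear[OF clinear_partial_t] a subspace_cs_0)+)
qed

section \<open>Module maps given by multiplication with a polynomial\<close>

lemma shift_s_1_fixed:
  assumes "shift_s 1 f = f"
  shows "f = [:poly f 0:]"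
proof -
  have step: "poly f (x - 1) = poly f x" for x
    using arg_cong[OF assms, of "\<lambda>f. poly f x"] by (simp add: shift_s_def poly_pcompose)
  have "poly f (- of_nat n) = poly f 0" for n
  proof (induction n)
    case (Suc n)
    have "- of_nat (Suc n) = - of_nat n - (1 :: complex poly)" by simp
    with step[of "- of_nat n"] Suc show ?case by (simp only:)
  qed simp
  \<comment> \<open>Over the integral domain \<complex>[t] a nonzero polynomial in s has finitely
    many roots, whereas f - f(0) vanishes at 0, -1, -2, and so on.\<close>
  then have sub: "range (\<lambda>n::nat. - of_nat n) \<subseteq> {x. poly (f - [:poly f 0:]) x = 0}"
    by auto
  have "inj (\<lambda>n::nat. - of_nat n :: complex poly)"
    by (simp add: inj_def)
  then have "infinite (range (\<lambda>n::nat. - of_nat n :: complex poly))"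
    using finite_imageD by blast
  with sub have "\<not> finite {x. poly (f - [:poly f 0:]) x = 0}"
    using finite_subset by blast
  then have "f - [:poly f 0:] = 0"
    using poly_roots_finite by blast
  then show ?thesis by simp
qed

lemma lead_coeff_shift_s: "lead_coeff (shift_s n f) = lead_coeff f"
  unfolding shift_s_def by (subst lead_coeff_comp) simp_all

text \<open>Compare degrees: a nonzero derivative has smaller degree than p, and a nonzero factor q
  cannot lower the degree.\<close>

lemma poly_mult_eq_pderiv_mult:
  fixes p q :: "complex poly"
  assumes "p \<noteq> 0" "q * p = Polynomial.smult c (pderiv p)"
  shows "q = 0"
proof (rule ccontr)
  assume q: "q \<noteq> 0"
  then have "q * p \<noteq> 0" using assms(1) by simp
  then have c: "c \<noteq> 0" and p': "pderiv p \<noteq> 0" using assms(2) by auto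
  then have "degree p \<noteq> 0" by (auto simp: pderiv_eq_0_iff)
  have "degree q + degree p = degree (pderiv p)"
    using assms q c by (metis degree_mult_eq degree_smult_eq)
  with \<open>degree p \<noteq> 0\<close> show False by (simp add: degree_pderiv)
qed

lemma h_sub_1: "h_sub \<alpha> h 1 = h"
  by (simp add: h_sub_def)

lemma H_poly_add_const: "H_poly \<alpha> (h + [:c:]) = H_poly \<alpha> h"
proof -
  have "h + [:c:] - [:poly (h + [:c:]) \<alpha>:] = h - [:poly h \<alpha>:]"
    by (rule poly_eqI) (simp add: coeff_pCons split: nat.split)
  then show ?thesis unfolding H_poly_def by (rule arg_cong)
qed

text \<open>The hypotheses say that multiplication by \<open>f\<close> intertwines the actions on the generator
  \<open>1\<close> of the first module.\<close>

lemma Phi_hom_generator: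
  assumes f: "f \<noteq> 0" and ab: "\<alpha> \<noteq> 0 \<or> \<beta> \<noteq> 0"
    and hom: "\<And>a. a \<in> {Wgen 1, Jgen 0, Igen 0, Igen 1, Lgen 1, Lgen 2} \<Longrightarrow>
        Phi_gen_act 1 \<alpha> \<beta> \<gamma> h a 1 * f = Phi_gen_act 1 \<alpha>' \<beta>' \<gamma>' h' a f"
  shows "\<alpha> = \<alpha>' \<and> \<beta> = \<beta>' \<and> \<gamma> = \<gamma>' \<and> h = h' \<and> (\<exists>c. f = [:[:c:]:])"
proof -
  have W: "[:[:- \<alpha>, 1:]:] * f = [:[:- \<alpha>', 1:]:] * shift_s 1 f"
    using hom[of "Wgen 1"] by (simp add: shift_s_simps)
  \<comment> \<open>The shift keeps the leading coefficient in s, so only t - \<alpha> and t -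
    \<alpha>' are left to compare.\<close>
  then have "[:- \<alpha>, 1:] * lead_coeff f = [:- \<alpha>', 1:] * lead_coeff f"
    using lead_coeff_mult[of "[:[:- \<alpha>, 1:]:]" f] lead_coeff_mult[of "[:[:- \<alpha>', 1:]:]" "shift_s 1 f"]
    by (simp only: lead_coeff_shift_s) simp
  moreover have "lead_coeff f \<noteq> 0" using f by simp
  ultimately have \<alpha>: "\<alpha> = \<alpha>'" by (metis mult_cancel_right pCons_eq_iff neg_equal_iff_equal)
  with W have fixed: "shift_s 1 f = f" by (metis mult_cancel_left pCons_eq_0_iff one_neq_zero)
  define p where "p = poly f 0"
  have fp: "f = [:p:]" using shift_s_1_fixed[OF fixed] by (simp add: p_def)
  with f have p: "p \<noteq> 0" by simp
  have \<beta>: "\<beta> = \<beta>'" using hom[of "Jgen 0"] p mult_right_cancel[of p "[:\<beta>:]" "[:\<beta>':]"]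
    by (simp add: shift_s_simps fp)
  have \<gamma>: "\<gamma> = \<gamma>'" using hom[of "Igen 0"] p mult_right_cancel[of p "[:\<gamma>:]" "[:\<gamma>':]"]
    by (simp add: shift_s_simps partial_t_simps fp)
  have L1: "(h' - h) * p = [:- \<alpha>, 1:] * pderiv p"
    using hom[of "Lgen 1"]
    by (simp add: shift_s_simps partial_t_simps fp h_sub_1 \<alpha> algebra_simps)
  have L2: "(h_sub \<alpha> h' 2 - h_sub \<alpha> h 2) * p = Polynomial.smult 2 ([:- 2 * \<alpha>, 1:] * pderiv p)"
    using hom[of "Lgen 2"]
    by (simp add: shift_s_simps partial_t_simps fp \<alpha> algebra_simps smult_diff_right)
  have I1: "(H_poly \<alpha> h' - H_poly \<alpha> h) * Polynomial.smult \<beta> p = Polynomial.smult \<beta> (pderiv p)"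
    using hom[of "Igen 1"]
    by (simp add: shift_s_simps partial_t_simps fp \<alpha> \<beta> \<gamma> algebra_simps)
  have "pderiv p = 0"
  proof (cases "\<beta> = 0")
    \<comment> \<open>For \<beta> \<noteq> 0 the derivative term of I_1 is decisive, by
      degrees.\<close>
    case False
    with I1 have "(H_poly \<alpha> h' - H_poly \<alpha> h) * p = Polynomial.smult 1 (pderiv p)"
      by simp (metis smult_cancel)
    with poly_mult_eq_pderiv_mult[OF p this] show ?thesis by simp
  next
    case True
    with ab have "\<alpha> \<noteq> 0" by simp
    \<comment> \<open>When p' is nonzero, (t - \<alpha>) p' has the degree of p, so
      \<open>L1\<close> leaves no room for a factor h' - h of positive degree.\<close>
    have "degree (h' - h) = 0"
    proof (rule ccontr)
      assume d: "degree (h' - h) \<noteq> 0"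
      then have "h' - h \<noteq> 0" by auto
      then have ne: "[:- \<alpha>, 1:] * pderiv p \<noteq> 0" using L1 p by (metis mult_eq_0_iff)
      then have "pderiv p \<noteq> 0" by auto
      then have "degree p \<noteq> 0" by (auto simp: pderiv_eq_0_iff)
      have "degree (h' - h) + degree p = Suc (degree (pderiv p))"
        using arg_cong[OF L1, of degree] \<open>h' - h \<noteq> 0\<close> p \<open>pderiv p \<noteq> 0\<close>
        by (simp add: degree_mult_eq del: mult_pCons_left)
      with \<open>degree p \<noteq> 0\<close> d show False by (simp add: degree_pderiv)
    qed
    then obtain c where "h' - h = [:c:]" by (metis degree_eq_zeroE)
    then have h': "h' = h + [:c:]" by (simp add: algebra_simps)
    \<comment> \<open>A constant difference does not change H, so the terms with H cancel and
      \<open>L2\<close> is, up to the factor 2, \<open>L1\<close> with 2\<alpha> in place of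
      \<alpha> on the right. Comparing the two gives \<alpha> p' = 0.\<close>
    then have "h_sub \<alpha> h' 2 - h_sub \<alpha> h 2 = Polynomial.smult 2 (h' - h)"
      by (simp add: h_sub_def H_poly_add_const algebra_simps numeral_poly smult_add_right)
    with L1 L2 have "[:- 2 * \<alpha>, 1:] * pderiv p = [:- \<alpha>, 1:] * pderiv p"
      by (metis mult_smult_left smult_cancel zero_neq_numeral)
    then have "pderiv p = 0 \<or> [:- 2 * \<alpha>, 1:] = [:- \<alpha>, 1:]"
      by (simp only: mult_cancel_right)
    then show ?thesis using \<open>\<alpha> \<noteq> 0\<close> by simp
  qed
  then have "\<exists>c. p = [:c:]" and "h = h'"
    using L1 p by (auto simp: pderiv_eq_0_iff elim: degree_eq_zeroE)
  with \<alpha> \<beta> \<gamma> fp show ?thesis by auto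
qed

section \<open>Linear maps on free vector spaces\<close>

lemma pm_extend_superset:
  "finite S \<Longrightarrow> Poly_Mapping.keys f \<subseteq> S \<Longrightarrow>
     pm_extend g f = (\<Sum>k\<in>S. pm_scale (Poly_Mapping.lookup f k) (g k))"
  unfolding pm_extend_def by (rule sum.mono_neutral_left) (auto simp: in_keys_iff)

lemma keys_pm_scale: "Poly_Mapping.keys (pm_scale c f) \<subseteq> Poly_Mapping.keys f"
  by (auto simp: in_keys_iff)

lemma pm_extend_add: "pm_extend g (f + f') = pm_extend g f + pm_extend g f'"
  using pm_extend_superset[of "Poly_Mapping.keys f \<union> Poly_Mapping.keys f'" f g]
    pm_extend_superset[of "Poly_Mapping.keys f \<union> Poly_Mapping.keys f'" f' g]
    pm_extend_superset[of "Poly_Mapping.keys f \<union> Poly_Mapping.keys f'" "f + f'" g] keys_add[of f f']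
  by (simp add: lookup_add pm.scale_left_distrib sum.distrib)

lemma pm_extend_scale: "pm_extend g (pm_scale c f) = pm_scale c (pm_extend g f)"
  using pm_extend_superset[of "Poly_Mapping.keys f" "pm_scale c f" g] keys_pm_scale[of c f]
  by (simp add: pm_extend_def pm.scale_sum_right)

lemma pm_extend_single [simp]: "pm_extend g (Poly_Mapping.single k c) = pm_scale c (g k)"
  using pm_extend_superset[of "{k}" "Poly_Mapping.single k c" g] by simp

abbreviation pm_linear :: "(('k \<Rightarrow>\<^sub>0 complex) \<Rightarrow> ('l \<Rightarrow>\<^sub>0 complex)) \<Rightarrow> bool" where
  "pm_linear \<equiv> Vector_Spaces.linear pm_scale pm_scale"

lemma pm_linear_extend: "pm_linear (pm_extend g)"
  by (simp add: Vector_Spaces.linear_iff pm.vector_space_axioms pm_extend_add pm_extend_scale)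

lemma pm_linear_simps:
  assumes "pm_linear L"
  shows "L (f + g) = L f + L g" "L (f - g) = L f - L g" "L (pm_scale c f) = pm_scale c (L f)"
    "L 0 = 0" "L (\<Sum>i\<in>I. F i) = (\<Sum>i\<in>I. L (F i))"
proof -
  interpret L: Vector_Spaces.linear pm_scale pm_scale L by fact
  show "L (f + g) = L f + L g" "L (f - g) = L f - L g" "L (pm_scale c f) = pm_scale c (L f)"
    "L 0 = 0" "L (\<Sum>i\<in>I. F i) = (\<Sum>i\<in>I. L (F i))"
    by (simp_all add: L.add L.diff L.scale L.zero L.sum)
qed

lemma pm_single_expand:
  "f = (\<Sum>k\<in>Poly_Mapping.keys f. pm_scale (Poly_Mapping.lookup f k) (Poly_Mapping.single k 1))"
  by (rule poly_mapping_eqI)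
     (auto simp: lookup_sum lookup_single when_def in_keys_iff if_distrib cong: if_cong)

lemma pm_mem_subspace:
  assumes "pm.subspace S" "\<And>k. k \<in> Poly_Mapping.keys f \<Longrightarrow> Poly_Mapping.single k 1 \<in> S"
  shows "f \<in> S"
  by (subst pm_single_expand) (intro pm.subspace_sum pm.subspace_scale assms)

lemma pm_linear_eqI:
  assumes "pm_linear L" "pm_linear L'" "\<And>k. L (Poly_Mapping.single k 1) = L' (Poly_Mapping.single k 1)"
  shows "L f = L' f"
proof -
  have "f \<in> {f. L f = L' f}"
    by (rule pm_mem_subspace)
       (auto intro!: pm.subspaceI simp: assms(3) pm_linear_simps[OF assms(1)] pm_linear_simps[OF assms(2)])
  then show ?thesis by simp
qed

section \<open>Modules over the algebra\<close>

lemma complex_ring_simps [simp]: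
  "carrier complex_ring = UNIV" "\<one>\<^bsub>complex_ring\<^esub> = 1" "\<zero>\<^bsub>complex_ring\<^esub> = 0"
  "a \<otimes>\<^bsub>complex_ring\<^esub> b = a * b" "a \<oplus>\<^bsub>complex_ring\<^esub> b = a + b"
  by (simp_all add: complex_ring_def)

context bms_module
begin

text \<open>The counterpart of \<open>pm_extend\<close> for a target that is a carrier with record
  operations, where sums must be taken by \<open>finsum\<close>.\<close>

definition lin_ext :: "('k \<Rightarrow> 'v) \<Rightarrow> ('k \<Rightarrow>\<^sub>0 complex) \<Rightarrow> 'v" where
  "lin_ext w f = (\<Oplus>k\<in>Poly_Mapping.keys f. Poly_Mapping.lookup f k \<odot> w k)"

context
  fixes w :: "'k \<Rightarrow> 'v"
  assumes w: "\<And>k. w k \<in> carrier V"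
begin

lemma lin_ext_closed [simp]: "lin_ext w f \<in> carrier V"
  unfolding lin_ext_def using w by (intro M.finsum_closed) auto

lemma smult_zero_left [simp]: "v \<in> carrier V \<Longrightarrow> 0 \<odot> v = \<zero>"
  using smult_l_null by simp

lemma lin_ext_superset:
  "finite S \<Longrightarrow> Poly_Mapping.keys f \<subseteq> S \<Longrightarrow> lin_ext w f = (\<Oplus>k\<in>S. Poly_Mapping.lookup f k \<odot> w k)"
  unfolding lin_ext_def using w
  by (intro M.add.finprod_mono_neutral_cong_left) (auto simp: in_keys_iff)

lemma lin_ext_add: "lin_ext w (f + g) = lin_ext w f \<oplus> lin_ext w g"
proof -
  define S where "S = Poly_Mapping.keys f \<union> Poly_Mapping.keys g"
  have S: "finite S" "Poly_Mapping.keys f \<subseteq> S" "Poly_Mapping.keys g \<subseteq> S" "Poly_Mapping.keys (f + g) \<subseteq> S"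
    using keys_add[of f g] by (auto simp: S_def)
  have "lin_ext w (f + g)
      = (\<Oplus>k\<in>S. Poly_Mapping.lookup f k \<odot> w k \<oplus> Poly_Mapping.lookup g k \<odot> w k)"
    using w S(1,4) smult_l_distr by (simp add: lin_ext_superset lookup_add)
  also have "\<dots> = lin_ext w f \<oplus> lin_ext w g"
    using w S by (simp add: lin_ext_superset M.finsum_addf Pi_def)
  finally show ?thesis .
qed

lemma lin_ext_scale: "lin_ext w (pm_scale c f) = c \<odot> lin_ext w f"
proof -
  have "lin_ext w (pm_scale c f) = (\<Oplus>k\<in>Poly_Mapping.keys f. c \<odot> (Poly_Mapping.lookup f k \<odot> w k))"
    using w smult_assoc1 by (simp add: lin_ext_superset[OF _ keys_pm_scale] Pi_def)
  also have "\<dots> = c \<odot> lin_ext w f"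
    unfolding lin_ext_def using w by (simp add: finsum_smult_ldistr Pi_def)
  finally show ?thesis .
qed

lemma lin_ext_single [simp]: "lin_ext w (Poly_Mapping.single k 1) = w k"
  using lin_ext_superset[of "{k}" "Poly_Mapping.single k 1"] w smult_one by simp

lemma lin_ext_zero [simp]: "lin_ext w 0 = \<zero>"
  by (simp add: lin_ext_def)

lemma lin_ext_diff_eq_zero_iff: "lin_ext w (f - g) = \<zero> \<longleftrightarrow> lin_ext w f = lin_ext w g"
proof -
  have "lin_ext w f = lin_ext w (f - g) \<oplus> lin_ext w g"
    by (subst lin_ext_add[symmetric]) simp
  then show ?thesis
    using M.add.r_cancel_one'[of "lin_ext w g" "lin_ext w (f - g)"] by auto
qed

lemma lin_ext_span_eq_zero:
  assumes "\<And>r. r \<in> S \<Longrightarrow> lin_ext w r = \<zero>" "f \<in> pm.span S"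
  shows "lin_ext w f = \<zero>"
proof -
  have "pm.subspace {f. lin_ext w f = \<zero>}"
    by (intro pm.subspaceI) (auto simp: lin_ext_add lin_ext_scale)
  then have "pm.span S \<subseteq> {f. lin_ext w f = \<zero>}"
    using assms(1) by (intro pm.span_minimal) auto
  with assms(2) show ?thesis by auto
qed

end

end

section \<open>Tensor products of polynomial modules with a module\<close>

text \<open>The point \<open>t = 1\<close> is chosen so that neither \<open>1\<close> nor \<open>t\<close> is annihilated.\<close>

definition ev_poly :: "complex poly poly \<Rightarrow> complex" where
  "ev_poly f = poly (poly f 0) 1"

text \<open>A linear projection onto the constants. Being fixed by its lift is how "constant in a
  slot" is expressed for elements of the tensor product.\<close>

definition const_part :: "complex poly poly \<Rightarrow> complex poly poly" where
  "const_part f = cscale (ev_poly f) 1"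

lemma ev_poly_simps:
  "ev_poly (f + g) = ev_poly f + ev_poly g" "ev_poly (cscale c f) = c * ev_poly f" "ev_poly 1 = 1"
  by (simp_all add: ev_poly_def cscale_def)

lemma clinear_const_part: "clinear const_part"
  by (rule clinearI) (simp_all add: const_part_def ev_poly_simps cs.scale_left_distrib)

lemma act_Phi: "act (Phi l \<alpha> \<beta> \<gamma> h) x f =
    (\<Sum>a\<in>Poly_Mapping.keys x. cscale (Poly_Mapping.lookup x a) (Phi_gen_act l \<alpha> \<beta> \<gamma> h a f))"
  by (simp add: Phi_def cscale_def)

lemma act_Phi_single: "act (Phi l \<alpha> \<beta> \<gamma> h) (Poly_Mapping.single a 1) = Phi_gen_act l \<alpha> \<beta> \<gamma> h a"
  by (rule ext) (simp add: act_Phi)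

lemma clinear_act_Phi: "clinear (act (Phi l \<alpha> \<beta> \<gamma> h) x)"
proof -
  interpret vector_space_pair cscale cscale ..
  show ?thesis
    unfolding act_Phi by (intro linear_compose_sum ballI linear_compose_scale_right clinear_Phi_gen_act)
qed

lemma Phi_simps [simp]:
  "carrier (Phi l \<alpha> \<beta> \<gamma> h) = UNIV" "f \<oplus>\<^bsub>Phi l \<alpha> \<beta> \<gamma> h\<^esub> g = f + g"
  "c \<odot>\<^bsub>Phi l \<alpha> \<beta> \<gamma> h\<^esub> f = cscale c f"
  by (simp_all add: Phi_def cscale_def)

section \<open>The free space, its relators and congruence modulo them\<close>

locale phi_tensor =
  fixes A :: "'i set" and l \<alpha> \<beta> \<gamma> :: "'i \<Rightarrow> complex" and h :: "'i \<Rightarrow> complex poly"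
    and V :: "'v bms_mod"
  assumes finite_A: "finite A" and V: "bms_module V"
begin

sublocale V: bms_module V by (rule V)

abbreviation M :: "'i \<Rightarrow> complex poly poly bms_mod" where
  "M i \<equiv> Phi (l i) (\<alpha> i) (\<beta> i) (\<gamma> i) (h i)"

definition gens :: "(('i \<Rightarrow> complex poly poly) \<times> 'v) set" where
  "gens = tensor_gens A M V"

definition free :: "(('i \<Rightarrow> complex poly poly) \<times> 'v \<Rightarrow>\<^sub>0 complex) set" where
  "free = tensor_free A M V"

definition R :: "(('i \<Rightarrow> complex poly poly) \<times> 'v \<Rightarrow>\<^sub>0 complex) set" where
  "R = pm.span (tensor_relators A M V)"

definition eqv (infix "\<simeq>" 50) where
  "f \<simeq> g \<longleftrightarrow> f - g \<in> R"

lemma gens_iff: "(u, v) \<in> gens \<longleftrightarrow> u \<in> extensional A \<and> v \<in> carrier V"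
  by (auto simp: gens_def tensor_gens_def PiE_def)

lemma gens_fun_upd [simp]: "(u, v) \<in> gens \<Longrightarrow> i \<in> A \<Longrightarrow> (u(i := a), v) \<in> gens"
  by (auto simp: gens_iff extensional_def)

lemma subspace_R [simp]: "pm.subspace R"
  by (simp add: R_def pm.subspace_span)

lemma subspace_free [simp]: "pm.subspace free"
proof (rule pm.subspaceI)
  fix f g c assume f: "f \<in> free" "g \<in> free"
  show "f + g \<in> free" "pm_scale c f \<in> free"
    using f keys_add[of f g] keys_pm_scale[of c f] by (auto simp: free_def tensor_free_def)
qed (simp add: free_def tensor_free_def)

lemma pure_free [simp]: "(u, v) \<in> gens \<Longrightarrow> pure u v \<in> free"
  by (simp add: free_def tensor_free_def gens_def)

lemmas free_closed [simp] = pm.subspace_0[OF subspace_free] pm.subspace_add[OF subspace_free]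
  pm.subspace_diff[OF subspace_free] pm.subspace_scale[OF subspace_free]
  pm.subspace_sum[OF subspace_free]

text \<open>Serves as an induction principle: a property that defines a subspace need only be
  checked on pure tensors.\<close>

lemma free_subset:
  assumes "pm.subspace S" "\<And>u v. (u, v) \<in> gens \<Longrightarrow> pure u v \<in> S"
  shows "free \<subseteq> S"
proof
  fix f assume "f \<in> free"
  show "f \<in> S"
  proof (rule pm_mem_subspace[OF assms(1)])
    fix k assume "k \<in> Poly_Mapping.keys f"
    with \<open>f \<in> free\<close> have "k \<in> gens"
      by (auto simp: free_def tensor_free_def gens_def)
    then show "Poly_Mapping.single k 1 \<in> S"
      using assms(2) by (cases k) simp
  qed
qed

lemma rel_slot_add: "(u, v) \<in> gens \<Longrightarrow> i \<in> A \<Longrightarrow>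
    pure (u(i := a + b)) v - pure (u(i := a)) v - pure (u(i := b)) v \<in> R"
  unfolding R_def gens_def tensor_relators_def Phi_simps
  by (rule pm.span_base, rule UnI1, rule UnI1, rule UnI1, rule CollectI, rule exI[of _ u], rule exI[of _ v], rule exI[of _ i], rule exI[of _ a], rule exI[of _ b]) simp

lemma rel_slot_scale: "(u, v) \<in> gens \<Longrightarrow> i \<in> A \<Longrightarrow>
    pure (u(i := cscale c a)) v - pm_scale c (pure (u(i := a)) v) \<in> R"
  unfolding R_def gens_def tensor_relators_def Phi_simps
  by (rule pm.span_base, rule UnI1, rule UnI1, rule UnI2, rule CollectI, rule exI[of _ u], rule exI[of _ v], rule exI[of _ i], rule exI[of _ c], rule exI[of _ a]) simp

lemma rel_add: "(u, v) \<in> gens \<Longrightarrow> w \<in> carrier V \<Longrightarrow>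
    pure u (v \<oplus>\<^bsub>V\<^esub> w) - pure u v - pure u w \<in> R"
  unfolding R_def gens_def tensor_relators_def Phi_simps
  by (rule pm.span_base, rule UnI1, rule UnI2, rule CollectI, rule exI[of _ u], rule exI[of _ v], rule exI[of _ w]) simp

lemma rel_scale: "(u, v) \<in> gens \<Longrightarrow> pure u (c \<odot>\<^bsub>V\<^esub> v) - pm_scale c (pure u v) \<in> R"
  unfolding R_def gens_def tensor_relators_def Phi_simps
  by (rule pm.span_base, rule UnI2, rule CollectI, rule exI[of _ u], rule exI[of _ v], rule exI[of _ c]) simp

lemma relators_cases:
  assumes "r \<in> tensor_relators A M V"
  obtains (slot_add) u v i a b where "(u, v) \<in> gens" "i \<in> A"
      "r = pure (u(i := a + b)) v - pure (u(i := a)) v - pure (u(i := b)) v"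
    | (slot_scale) u v i c a where "(u, v) \<in> gens" "i \<in> A"
      "r = pure (u(i := cscale c a)) v - pm_scale c (pure (u(i := a)) v)"
    | (add) u v w where "(u, v) \<in> gens" "w \<in> carrier V"
      "r = pure u (v \<oplus>\<^bsub>V\<^esub> w) - pure u v - pure u w"
    | (scale) u v c where "(u, v) \<in> gens"
      "r = pure u (c \<odot>\<^bsub>V\<^esub> v) - pm_scale c (pure u v)"
  using assms unfolding tensor_relators_def gens_def[symmetric] by auto

lemma gens_V [simp]: "(u, v) \<in> gens \<Longrightarrow> v \<in> carrier V"
  by (simp add: gens_iff)

lemma gens_change: "(u, v) \<in> gens \<Longrightarrow> w \<in> carrier V \<Longrightarrow> (u, w) \<in> gens"
  by (simp add: gens_iff)

lemma R_subset_free: "R \<subseteq> free"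
  unfolding R_def
proof (rule pm.span_minimal)
  show "tensor_relators A M V \<subseteq> free"
  proof
    fix r assume "r \<in> tensor_relators A M V"
    then show "r \<in> free"
      by (cases rule: relators_cases) (simp_all add: gens_iff extensional_def)
  qed
qed simp

lemma R_subset:
  assumes "pm.subspace S" "\<And>r. r \<in> tensor_relators A M V \<Longrightarrow> r \<in> S"
  shows "R \<subseteq> S"
  unfolding R_def using assms by (intro pm.span_minimal) auto

lemma eqv_refl [simp]: "f \<simeq> f"
  by (simp add: eqv_def pm.subspace_0)

lemma eqv_sym: "f \<simeq> g \<Longrightarrow> g \<simeq> f"
  unfolding eqv_def by (metis minus_diff_eq pm.subspace_neg subspace_R)

lemma eqv_trans [trans]: "f \<simeq> g \<Longrightarrow> g \<simeq> k \<Longrightarrow> f \<simeq> k"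
  unfolding eqv_def using pm.subspace_add[OF subspace_R, of "f - g" "g - k"] by simp

lemma eqv_add: "f \<simeq> g \<Longrightarrow> f' \<simeq> g' \<Longrightarrow> f + f' \<simeq> g + g'"
  unfolding eqv_def using pm.subspace_add[OF subspace_R, of "f - g" "f' - g'"]
  by (simp add: algebra_simps)

lemma eqv_scale: "f \<simeq> g \<Longrightarrow> pm_scale c f \<simeq> pm_scale c g"
  unfolding eqv_def using pm.subspace_scale[OF subspace_R, of "f - g" c]
  by (simp add: pm.scale_right_diff_distrib)

lemma eqv_diff: "f \<simeq> g \<Longrightarrow> f' \<simeq> g' \<Longrightarrow> f - f' \<simeq> g - g'"
  unfolding eqv_def using pm.subspace_diff[OF subspace_R, of "f - g" "f' - g'"]
  by (simp add: algebra_simps)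

lemma eqv_sum: "(\<And>i. i \<in> I \<Longrightarrow> f i \<simeq> g i) \<Longrightarrow> (\<Sum>i\<in>I. f i) \<simeq> (\<Sum>i\<in>I. g i)"
  unfolding eqv_def sum_subtractf[symmetric] by (rule pm.subspace_sum) auto

lemma eqv_0_iff: "f \<simeq> 0 \<longleftrightarrow> f \<in> R"
  by (simp add: eqv_def)

lemma eqv_linear:
  assumes L: "pm_linear L" and L': "pm_linear L'"
    and gen: "\<And>u v. (u, v) \<in> gens \<Longrightarrow> L (pure u v) \<simeq> L' (pure u v)"
    and f: "f \<in> free"
  shows "L f \<simeq> L' f"
proof -
  have "free \<subseteq> {f. L f \<simeq> L' f}"
  proof (rule free_subset)
    show "pm.subspace {f. L f \<simeq> L' f}"
      by (rule pm.subspaceI)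
         (auto simp: pm_linear_simps[OF L] pm_linear_simps[OF L'] eqv_add eqv_scale)
  qed (use gen in auto)
  with f show ?thesis by auto
qed

section \<open>Operators acting in one factor\<close>

definition lift :: "'i \<Rightarrow> (complex poly poly \<Rightarrow> complex poly poly) \<Rightarrow>
    (('i \<Rightarrow> complex poly poly) \<times> 'v \<Rightarrow>\<^sub>0 complex) \<Rightarrow> (('i \<Rightarrow> complex poly poly) \<times> 'v \<Rightarrow>\<^sub>0 complex)" where
  "lift i B = pm_extend (\<lambda>(u, v). pure (u(i := B (u i))) v)"

definition lift_V :: "('v \<Rightarrow> 'v) \<Rightarrow>
    (('i \<Rightarrow> complex poly poly) \<times> 'v \<Rightarrow>\<^sub>0 complex) \<Rightarrow> (('i \<Rightarrow> complex poly poly) \<times> 'v \<Rightarrow>\<^sub>0 complex)" where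
  "lift_V X = pm_extend (\<lambda>(u, v). pure u (X v))"

lemma linear_lift: "pm_linear (lift i B)" and linear_lift_V: "pm_linear (lift_V X)"
  by (simp_all add: lift_def lift_V_def pm_linear_extend)

lemmas lift_linear_simps = pm_linear_simps[OF linear_lift]
lemmas lift_V_linear_simps = pm_linear_simps[OF linear_lift_V]

lemma lift_pure [simp]: "lift i B (pure u v) = pure (u(i := B (u i))) v"
  by (simp add: lift_def)

lemma lift_V_pure [simp]: "lift_V X (pure u v) = pure u (X v)"
  by (simp add: lift_V_def)

lemma lift_free: "f \<in> free \<Longrightarrow> i \<in> A \<Longrightarrow> lift i B f \<in> free"
proof -
  assume i: "i \<in> A"
  have "free \<subseteq> {f. lift i B f \<in> free}"
    by (rule free_subset) (auto intro!: pm.subspaceI simp: lift_linear_simps i)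
  then show "f \<in> free \<Longrightarrow> lift i B f \<in> free" by auto
qed

lemma lift_V_free:
  assumes "\<And>v. v \<in> carrier V \<Longrightarrow> X v \<in> carrier V" "f \<in> free"
  shows "lift_V X f \<in> free"
proof -
  have "free \<subseteq> {f. lift_V X f \<in> free}"
    by (rule free_subset) (auto intro!: pm.subspaceI simp: lift_V_linear_simps gens_iff assms(1))
  with assms(2) show ?thesis by auto
qed

lemma clinear_simps:
  assumes "clinear B"
  shows "B (a + b) = B a + B b" "B (cscale c a) = cscale c (B a)"
  using assms by (simp_all add: Vector_Spaces.linear_iff)

text \<open>Applied in the slot of a relator, a linear B yields the relator of the images; applied
  in another slot it yields the same relator with a changed \<open>u\<close>. Hence
  \<open>lift i B\<close> descends to the quotient.\<close>

lemma lift_R: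
  assumes i: "i \<in> A" and B: "clinear B" and f: "f \<in> R"
  shows "lift i B f \<in> R"
proof -
  have "R \<subseteq> {f. lift i B f \<in> R}"
  proof (rule R_subset)
    show "pm.subspace {f. lift i B f \<in> R}"
      by (rule pm.subspaceI) (auto simp: lift_linear_simps pm.subspace_0 pm.subspace_add pm.subspace_scale)
    fix r assume "r \<in> tensor_relators A M V"
    then show "r \<in> {f. lift i B f \<in> R}"
    proof (cases rule: relators_cases)
      case (slot_add u v j a b)
      then show ?thesis
        using rel_slot_add[OF slot_add(1) i, of "B a" "B b"]
          rel_slot_add[OF gens_fun_upd[OF slot_add(1) i] slot_add(2), of "B (u i)" a b]
        by (cases "i = j") (simp_all add: lift_linear_simps clinear_simps[OF B] fun_upd_twist)
    next
      case (slot_scale u v j c a)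
      then show ?thesis
        using rel_slot_scale[OF slot_scale(1) i, of c "B a"]
          rel_slot_scale[OF gens_fun_upd[OF slot_scale(1) i] slot_scale(2), of "B (u i)" c a]
        by (cases "i = j") (simp_all add: lift_linear_simps clinear_simps[OF B] fun_upd_twist)
    next
      case (add u v w)
      then show ?thesis
        using rel_add[OF gens_fun_upd[OF add(1) i] add(2)] by (simp add: lift_linear_simps)
    next
      case (scale u v c)
      then show ?thesis
        using rel_scale[OF gens_fun_upd[OF scale(1) i]] by (simp add: lift_linear_simps)
    qed
  qed
  with f show ?thesis by auto
qed

lemma lift_V_R:
  assumes X: "\<And>v. v \<in> carrier V \<Longrightarrow> X v \<in> carrier V"
    and add: "\<And>v w. v \<in> carrier V \<Longrightarrow> w \<in> carrier V \<Longrightarrow> X (v \<oplus>\<^bsub>V\<^esub> w) = X v \<oplus>\<^bsub>V\<^esub> X w"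
    and scale: "\<And>c v. v \<in> carrier V \<Longrightarrow> X (c \<odot>\<^bsub>V\<^esub> v) = c \<odot>\<^bsub>V\<^esub> X v"
    and f: "f \<in> R"
  shows "lift_V X f \<in> R"
proof -
  have "R \<subseteq> {f. lift_V X f \<in> R}"
  proof (rule R_subset)
    show "pm.subspace {f. lift_V X f \<in> R}"
      by (rule pm.subspaceI) (auto simp: lift_V_linear_simps pm.subspace_0 pm.subspace_add pm.subspace_scale)
    fix r assume "r \<in> tensor_relators A M V"
    then show "r \<in> {f. lift_V X f \<in> R}"
      by (cases rule: relators_cases)
         (simp_all add: lift_V_linear_simps add scale X rel_add rel_scale rel_slot_add rel_slot_scale
           gens_change[of _ _ "X _"])
  qed
  with f show ?thesis by auto
qed

lemma lift_comp: "lift i (B \<circ> C) f = lift i B (lift i C f)"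
proof -
  have "pm_linear (\<lambda>f. lift i B (lift i C f))"
    by (simp add: Vector_Spaces.linear_iff pm.vector_space_axioms lift_linear_simps)
  from pm_linear_eqI[OF linear_lift this, of i "B \<circ> C"] show ?thesis
    by auto
qed

lemma lift_id: "lift i (\<lambda>x. x) f = f"
proof -
  have "pm_linear (\<lambda>f :: ('i \<Rightarrow> complex poly poly) \<times> 'v \<Rightarrow>\<^sub>0 complex. f)"
    by (simp add: Vector_Spaces.linear_iff pm.vector_space_axioms)
  from pm_linear_eqI[OF linear_lift this, of i "\<lambda>x. x"] show ?thesis
    by auto
qed

text \<open>Composition of operators is respected exactly, sums only modulo relators, because
  \<open>pure\<close> is not additive in a slot. The hypotheses of \<open>annihilator_kernel\<close>
  have the same shape.\<close>

lemma lift_add: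
  assumes "i \<in> A" "f \<in> free"
  shows "lift i (\<lambda>x. B x + C x) f \<simeq> lift i B f + lift i C f"
proof (rule eqv_linear[OF linear_lift _ _ assms(2)])
  show "pm_linear (\<lambda>f. lift i B f + lift i C f)"
    by (simp add: Vector_Spaces.linear_iff pm.vector_space_axioms lift_linear_simps pm.scale_right_distrib)
  show "lift i (\<lambda>x. B x + C x) (pure u v) \<simeq> lift i B (pure u v) + lift i C (pure u v)"
    if "(u, v) \<in> gens" for u v
    using rel_slot_add[OF that assms(1)] by (simp add: eqv_def diff_diff_add)
qed

lemma lift_scale:
  assumes "i \<in> A" "f \<in> free"
  shows "lift i (\<lambda>x. cscale c (B x)) f \<simeq> pm_scale c (lift i B f)"
proof (rule eqv_linear[OF linear_lift _ _ assms(2)])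
  show "pm_linear (\<lambda>f. pm_scale c (lift i B f))"
    by (simp add: Vector_Spaces.linear_iff pm.vector_space_axioms lift_linear_simps pm.scale_right_distrib mult.commute)
  show "lift i (\<lambda>x. cscale c (B x)) (pure u v) \<simeq> pm_scale c (lift i B (pure u v))"
    if "(u, v) \<in> gens" for u v
    using rel_slot_scale[OF that assms(1)] by (simp add: eqv_def)
qed

lemma lift_zero: "i \<in> A \<Longrightarrow> f \<in> free \<Longrightarrow> lift i (\<lambda>_. 0) f \<in> R"
  using lift_scale[of i f 0 "\<lambda>_. 0"] by (simp add: eqv_def)

text \<open>On a pure tensor the sequence passes through the slot map, which is linear modulo R;
  linear combinations follow.\<close>

lemma lift_poly_seq:
  assumes "i \<in> A" "f \<in> free" "\<And>x. csc.poly_seq {0} (\<lambda>n. B n x)"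
  shows "pmc.poly_seq R (\<lambda>n. lift i (B n) f)"
proof -
  have pure: "pmc.poly_seq R (\<lambda>n. lift i (B n) (pure u v))" if uv: "(u, v) \<in> gens" for u v
    unfolding lift_pure
  proof (rule pmc.poly_seq_linear_mod[OF subspace_cs_0 subspace_R cs.vector_space_axioms
        _ _ _ assms(3), where g = "\<lambda>a. pure (u(i := a)) v"])
    show "pure (u(i := x + y)) v - (pure (u(i := x)) v + pure (u(i := y)) v) \<in> R" for x y
      using rel_slot_add[OF uv assms(1)] by (simp add: diff_diff_add)
    show "pure (u(i := cscale c x)) v - pm_scale c (pure (u(i := x)) v) \<in> R" for c x
      using rel_slot_scale[OF uv assms(1)] .
    show "pure (u(i := x)) v \<in> R" if "x \<in> {0}" for x
      using rel_slot_scale[OF uv assms(1), of 0 0] that by simp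
  qed
  have "free \<subseteq> {f. pmc.poly_seq R (\<lambda>n. lift i (B n) f)}"
    by (rule free_subset)
       (auto intro!: pm.subspaceI[of "{f. pmc.poly_seq R (\<lambda>n. lift i (B n) f)}"] pmc.poly_seq_add
         pmc.poly_seq_scale pmc.poly_seq_const pure simp: lift_linear_simps simp del: lift_pure)
  with assms(2) show ?thesis by auto
qed

definition Act :: "bms \<Rightarrow> (('i \<Rightarrow> complex poly poly) \<times> 'v \<Rightarrow>\<^sub>0 complex) \<Rightarrow>
    (('i \<Rightarrow> complex poly poly) \<times> 'v \<Rightarrow>\<^sub>0 complex)" where
  "Act x = tensor_act A M V x"

lemma linear_Act: "pm_linear (Act x)"
  by (simp add: Act_def tensor_act_def pm_linear_extend)

lemma Act_eq: "Act x f = (\<Sum>i\<in>A. lift i (act (M i) x) f) + lift_V (act V x) f"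
proof -
  have "pm_linear (\<lambda>f. (\<Sum>i\<in>A. lift i (act (M i) x) f) + lift_V (act V x) f)"
    by (simp add: Vector_Spaces.linear_iff pm.vector_space_axioms lift_linear_simps lift_V_linear_simps
        sum.distrib pm.scale_right_distrib pm.scale_sum_right algebra_simps)
  from pm_linear_eqI[OF linear_Act this, of x] show ?thesis
    by (auto simp: Act_def tensor_act_def)
qed

lemma lift_V_act_R: "f \<in> R \<Longrightarrow> lift_V (act V x) f \<in> R"
  by (rule lift_V_R) (simp_all add: V.act_closed V.act_add_right V.act_scale_right)

lemma Act_free: "f \<in> free \<Longrightarrow> Act x f \<in> free"
  unfolding Act_eq by (intro free_closed lift_free lift_V_free) (auto simp: V.act_closed)

lemma Act_R: "f \<in> R \<Longrightarrow> Act x f \<in> R"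
  unfolding Act_eq
  by (intro pm.subspace_add pm.subspace_sum subspace_R lift_R clinear_act_Phi lift_V_act_R)

section \<open>Evaluation of all slots\<close>

definition ev_gen :: "('i \<Rightarrow> complex poly poly) \<times> 'v \<Rightarrow> 'v" where
  "ev_gen k = (if k \<in> gens then (\<Prod>i\<in>A. ev_poly (fst k i)) \<odot>\<^bsub>V\<^esub> snd k else \<zero>\<^bsub>V\<^esub>)"

text \<open>Contracts every slot with \<open>ev_poly\<close>, so that v is recovered from 1
  \<otimes> v; this is what detects nonzero elements of the quotient. The value zero of
  \<open>ev_gen\<close> off the generators keeps it in the carrier for all keys, as
  \<open>lin_ext\<close> requires.\<close>

definition ev :: "(('i \<Rightarrow> complex poly poly) \<times> 'v \<Rightarrow>\<^sub>0 complex) \<Rightarrow> 'v" where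
  "ev = V.lin_ext ev_gen"

lemma ev_gen_closed: "ev_gen k \<in> carrier V"
  by (cases k) (auto simp: ev_gen_def)

lemma ev_closed: "ev f \<in> carrier V"
  and ev_add: "ev (f + g) = ev f \<oplus>\<^bsub>V\<^esub> ev g"
  and ev_scale: "ev (pm_scale c f) = c \<odot>\<^bsub>V\<^esub> ev f"
  and ev_zero: "ev 0 = \<zero>\<^bsub>V\<^esub>"
  unfolding ev_def
  by (rule V.lin_ext_closed V.lin_ext_add V.lin_ext_scale V.lin_ext_zero, rule ev_gen_closed)+

lemmas ev_simps = ev_closed ev_add ev_scale ev_zero

lemma ev_pure: "(u, v) \<in> gens \<Longrightarrow> ev (pure u v) = (\<Prod>i\<in>A. ev_poly (u i)) \<odot>\<^bsub>V\<^esub> v"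
  by (simp add: ev_def V.lin_ext_single[OF ev_gen_closed] ev_gen_def)

lemma prod_ev_fun_upd:
  "i \<in> A \<Longrightarrow> (\<Prod>j\<in>A. ev_poly ((u(i := a)) j)) = ev_poly a * (\<Prod>j\<in>A - {i}. ev_poly (u j))"
  by (simp add: prod.remove[OF finite_A])

lemma ev_diff_eq_zero_iff: "ev (f - g) = \<zero>\<^bsub>V\<^esub> \<longleftrightarrow> ev f = ev g"
  unfolding ev_def by (rule V.lin_ext_diff_eq_zero_iff[OF ev_gen_closed])

lemma ev_R: "f \<in> R \<Longrightarrow> ev f = \<zero>\<^bsub>V\<^esub>"
  unfolding R_def ev_def
proof (rule V.lin_ext_span_eq_zero[OF ev_gen_closed])
  fix r assume "r \<in> tensor_relators A M V"
  then have "ev r = \<zero>\<^bsub>V\<^esub>"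
  proof (cases rule: relators_cases)
    case (slot_add u v i a b)
    then show ?thesis
      unfolding slot_add(3) diff_diff_add ev_diff_eq_zero_iff ev_add
      by (simp add: ev_pure prod_ev_fun_upd ev_poly_simps distrib_right V.smult_l_distr[simplified] del: fun_upd_apply)
  next
    case (slot_scale u v i c a)
    then show ?thesis
      unfolding slot_scale(3) ev_diff_eq_zero_iff
      by (simp add: ev_simps ev_pure prod_ev_fun_upd ev_poly_simps V.smult_assoc1[simplified, symmetric] mult.assoc del: fun_upd_apply)
  next
    case (add u v w)
    then show ?thesis
      unfolding add(3) diff_diff_add ev_diff_eq_zero_iff
      by (simp add: ev_simps ev_pure gens_change[OF add(1)] V.smult_r_distr)
  next
    case (scale u v c)
    then show ?thesis
      unfolding scale(2) ev_diff_eq_zero_iff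
      by (simp add: ev_simps ev_pure gens_change[OF scale(1)] V.smult_assoc1[simplified, symmetric] mult.commute)
  qed
  then show "V.lin_ext ev_gen r = \<zero>\<^bsub>V\<^esub>" by (simp add: ev_def)
qed

lemma ev_eqv: "f \<simeq> g \<Longrightarrow> ev f = ev g"
  by (metis ev_R ev_diff_eq_zero_iff eqv_def)

definition ones :: "'i \<Rightarrow> complex poly poly" where
  "ones = (\<lambda>i\<in>A. 1)"

lemma ones_gens [simp]: "v \<in> carrier V \<Longrightarrow> (ones, v) \<in> gens"
  by (simp add: gens_iff ones_def)

lemma ev_pure_ones: "v \<in> carrier V \<Longrightarrow> ev (pure ones v) = v"
  by (simp add: ev_pure) (simp add: ones_def ev_poly_simps V.smult_one[simplified])

text \<open>In each slot the entry may be replaced by a scalar multiple of 1, and the scalar can be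
  moved into V. Doing this slot by slot collects the product of the evaluations, which is
  \<open>ev\<close>.\<close>

lemma const_part_eqv_pure_ones:
  assumes f: "f \<in> free" and const: "\<And>i. i \<in> A \<Longrightarrow> lift i const_part f \<simeq> f"
  shows "f \<simeq> pure ones (ev f)"
proof -
  define w where "w B u v = (\<Prod>i\<in>B. ev_poly (u i)) \<odot>\<^bsub>V\<^esub> v"
    for B :: "'i set" and u :: "'i \<Rightarrow> complex poly poly" and v
  define z where "z B u i = (if i \<in> B then 1 else u i)"
    for B :: "'i set" and u :: "'i \<Rightarrow> complex poly poly" and i
  \<comment> \<open>The intermediate stage: the slots in B have been emptied and their scalars
    absorbed by V.\<close>
  define Q where "Q B = pm_extend (\<lambda>(u, v). pure (z B u) (w B u v))" for B
  have z0: "z {} u = u" for u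
    by (auto simp: z_def)
  have Q_pure: "Q B (pure u v) = pure (z B u) (w B u v)" for B u v
    by (simp add: Q_def)
  have lin: "pm_linear (Q B)" for B
    by (simp add: Q_def pm_linear_extend)
  have gens: "(z B u, w B u v) \<in> gens" if "B \<subseteq> A" "(u, v) \<in> gens" for B u v
    using that by (auto simp: gens_iff z_def w_def extensional_def)
  have "f \<simeq> Q B f" if "finite B" "B \<subseteq> A" for B
    using that
  proof (induction B)
    case empty
    have "pure u v = Q {} (pure u v)" if "(u, v) \<in> gens" for u v
      using that by (simp add: Q_pure z0 w_def V.smult_one[simplified])
    moreover have "pm_linear (\<lambda>f :: ('i \<Rightarrow> complex poly poly) \<times> 'v \<Rightarrow>\<^sub>0 complex. f)"
      by (simp add: Vector_Spaces.linear_iff pm.vector_space_axioms)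
    ultimately show ?case
      using eqv_linear[OF _ lin _ f, of "\<lambda>f. f"] by simp
  next
    case (insert i B)
    then have i: "i \<in> A" and B: "B \<subseteq> A" by auto
    have "f \<simeq> lift i const_part f" using const[OF i] by (rule eqv_sym)
    also have "lift i const_part f \<simeq> lift i const_part (Q B f)"
      using lift_R[OF i clinear_const_part, of "f - Q B f"] insert
      by (simp add: eqv_def lift_linear_simps)
    also have "lift i const_part (Q B f) \<simeq> Q (insert i B) f"
    proof (rule eqv_linear[OF _ lin _ f])
      show "pm_linear (\<lambda>f. lift i const_part (Q B f))"
        by (simp add: Vector_Spaces.linear_iff pm.vector_space_axioms lift_linear_simps pm_linear_simps[OF lin])
      fix u v assume uv: "(u, v) \<in> gens"
      have upd: "(z B u)(i := 1) = z (insert i B) u"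
        by (auto simp: z_def)
      have w: "w (insert i B) u v = ev_poly (u i) \<odot>\<^bsub>V\<^esub> w B u v"
        using insert uv by (simp add: w_def V.smult_assoc1[simplified])
      have 1: "lift i const_part (Q B (pure u v)) = pure ((z B u)(i := cscale (ev_poly (u i)) 1)) (w B u v)"
        using insert by (simp add: Q_pure const_part_def z_def)
      have 2: "pure ((z B u)(i := cscale (ev_poly (u i)) 1)) (w B u v)
          \<simeq> pm_scale (ev_poly (u i)) (pure ((z B u)(i := 1)) (w B u v))"
        using rel_slot_scale[OF gens[OF B uv] i] by (simp add: eqv_def)
      have 3: "pm_scale (ev_poly (u i)) (pure ((z B u)(i := 1)) (w B u v))
          \<simeq> pure ((z B u)(i := 1)) (ev_poly (u i) \<odot>\<^bsub>V\<^esub> w B u v)"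
        using rel_scale[OF gens_fun_upd[OF gens[OF B uv] i, of 1]] by - (rule eqv_sym, simp add: eqv_def)
      have 4: "Q (insert i B) (pure u v) = pure ((z B u)(i := 1)) (ev_poly (u i) \<odot>\<^bsub>V\<^esub> w B u v)"
        by (simp only: Q_pure w upd)
      show "lift i const_part (Q B (pure u v)) \<simeq> Q (insert i B) (pure u v)"
        unfolding 1 4 by (rule eqv_trans[OF 2 3])
    qed
    finally show ?case .
  qed
  from this[OF finite_A] have "f \<simeq> Q A f" by simp
  also have "Q A f \<simeq> pure ones (ev f)"
  proof -
    have "free \<subseteq> {f. Q A f \<simeq> pure ones (ev f)}"
    proof (rule free_subset)
      show "pm.subspace {f. Q A f \<simeq> pure ones (ev f)}"
      proof (rule pm.subspaceI; clarsimp)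
        \<comment> \<open>The generator with second component zero is not the zero of the free
          space; it vanishes only modulo a scaling relator.\<close>
        show "Q A 0 \<simeq> pure ones (ev 0)"
          using rel_scale[of ones "\<zero>\<^bsub>V\<^esub>" 0]
          by (simp add: pm_linear_simps[OF lin] ev_simps V.smult_r_null[simplified])
             (rule eqv_sym, simp add: eqv_0_iff)
        show "Q A (f + g) \<simeq> pure ones (ev (f + g))"
          if "Q A f \<simeq> pure ones (ev f)" "Q A g \<simeq> pure ones (ev g)" for f g
        proof -
          have "Q A (f + g) \<simeq> pure ones (ev f) + pure ones (ev g)"
            using eqv_add[OF that] by (simp add: pm_linear_simps[OF lin])
          also have "\<dots> \<simeq> pure ones (ev (f + g))"
            using rel_add[of ones "ev f" "ev g"]
            by - (rule eqv_sym, simp add: ev_simps eqv_def diff_diff_add)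
          finally show ?thesis .
        qed
        show "Q A (pm_scale c f) \<simeq> pure ones (ev (pm_scale c f))"
          if "Q A f \<simeq> pure ones (ev f)" for c f
        proof -
          have "Q A (pm_scale c f) \<simeq> pm_scale c (pure ones (ev f))"
            using eqv_scale[OF that] by (simp only: pm_linear_simps[OF lin])
          also have "\<dots> \<simeq> pure ones (ev (pm_scale c f))"
            using rel_scale[of ones "ev f" c] by - (rule eqv_sym, simp add: ev_simps eqv_def)
          finally show ?thesis .
        qed
      qed
      show "pure u v \<in> {f. Q A f \<simeq> pure ones (ev f)}" if "(u, v) \<in> gens" for u v
      proof -
        have "z A u = ones"
          using that by (auto simp: z_def ones_def gens_iff extensional_def)
        with that show ?thesis by (simp add: Q_pure w_def ev_pure)
      qed
    qed
    with f show ?thesis by auto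
  qed
  finally show ?thesis .
qed

end

section \<open>Lifted isomorphisms\<close>

lemma bms_gen_cases:
  obtains K n where "a = K n" "K \<in> gen_kinds"
  by (cases a) (auto simp: gen_kinds_def)

text \<open>At index 0 shift and derivative disappear; multiplications by s and t remain, which
  together with the constants generate all of \<complex>[s,t].\<close>

lemma Phi_gen_act_0:
  "Phi_gen_act 1 \<alpha> \<beta> \<gamma> h (Lgen 0) = (*) [:0, 1:]"
  "Phi_gen_act 1 \<alpha> \<beta> \<gamma> h (Wgen 0) = (*) [:[:0, 1:]:]"
  by (simp_all add: fun_eq_iff h_sub_def shift_s_simps flip: one_pCons)

context phi_tensor
begin

abbreviation op :: "'i \<Rightarrow> bms_gen \<Rightarrow> complex poly poly \<Rightarrow> complex poly poly" where
  "op i \<equiv> Phi_gen_act 1 (\<alpha> i) (\<beta> i) (\<gamma> i) (h i)"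

lemma lift_act:
  assumes "i \<in> A" "f \<in> free" "K \<in> gen_kinds"
  shows "lift i (act (M i) (Poly_Mapping.single (K n) 1)) f
    \<simeq> pm_scale (l i powi n) (lift i (op i (K n)) f)"
proof -
  have "act (M i) (Poly_Mapping.single (K n) 1) = (\<lambda>x. cscale (l i powi n) (op i (K n) x))"
    by (rule ext) (simp only: act_Phi_single Phi_gen_act_powi[OF assms(3), of "l i"])
  with lift_scale[OF assms(1,2)] show ?thesis by simp
qed

lemma lift_diff:
  assumes "i \<in> A" "f \<in> free"
  shows "lift i (\<lambda>x. B x - C x) f \<simeq> lift i B f - lift i C f"
proof -
  have "lift i (\<lambda>x. B x + cscale (- 1) (C x)) f \<simeq> lift i B f + lift i (\<lambda>x. cscale (- 1) (C x)) f"
    by (rule lift_add[OF assms])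
  also have "\<dots> \<simeq> lift i B f + pm_scale (- 1) (lift i C f)"
    by (rule eqv_add[OF eqv_refl lift_scale[OF assms]])
  finally show ?thesis by simp
qed

lemma lift_eqv: "i \<in> A \<Longrightarrow> clinear B \<Longrightarrow> f \<simeq> g \<Longrightarrow> lift i B f \<simeq> lift i B g"
  using lift_R[of i B "f - g"] by (simp add: eqv_def lift_linear_simps)

text \<open>Each pure tensor has its own bound, and the maximum serves for a sum; so the bound
  depends on \<open>f\<close>.\<close>

lemma lift_V_restricted:
  assumes V: "bms_restricted V" and f: "f \<in> free" and K: "K \<in> gen_kinds"
  shows "\<exists>k. \<forall>n\<ge>k. lift_V (act V (Poly_Mapping.single (K (int n)) 1)) f \<in> R"
proof -
  define S where "S = {f. \<exists>k. \<forall>n\<ge>k. lift_V (act V (Poly_Mapping.single (K (int n)) 1)) f \<in> R}"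
  have "free \<subseteq> S"
  proof (rule free_subset)
    show "pm.subspace S"
    proof (rule pm.subspaceI)
      show "0 \<in> S" by (simp add: S_def lift_V_linear_simps pm.subspace_0)
      show "pm_scale c x \<in> S" if "x \<in> S" for c x
        using that pm.subspace_scale[OF subspace_R, of _ c] by (simp add: S_def lift_V_linear_simps) blast
      fix x y assume "x \<in> S" "y \<in> S"
      then obtain k k' where
        "\<forall>n\<ge>k. lift_V (act V (Poly_Mapping.single (K (int n)) 1)) x \<in> R"
        "\<forall>n\<ge>k'. lift_V (act V (Poly_Mapping.single (K (int n)) 1)) y \<in> R"
        unfolding S_def by blast
      then have "\<forall>n\<ge>max k k'. lift_V (act V (Poly_Mapping.single (K (int n)) 1)) (x + y) \<in> R"
        by (simp add: lift_V_linear_simps pm.subspace_add)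
      then show "x + y \<in> S" unfolding S_def by blast
    qed
    fix u v assume uv: "(u, v) \<in> gens"
    then obtain k where k: "\<forall>n\<ge>int k. \<forall>x\<in>bms_grade n. act V x v = \<zero>\<^bsub>V\<^esub>"
      using V gens_V[OF uv] unfolding bms_restricted_def by blast
    have zero: "pure u \<zero>\<^bsub>V\<^esub> \<in> R"
      using rel_scale[OF uv, of 0] V.smult_l_null[OF gens_V[OF uv]] by simp
    have "Poly_Mapping.single (K n) 1 \<in> bms_grade n" for n
      using K by (auto simp: bms_grade_def gen_kinds_def)
    then have "act V (Poly_Mapping.single (K (int n)) 1) v = \<zero>\<^bsub>V\<^esub>" if "n \<ge> k" for n
      using that k by (metis of_nat_le_iff)
    with zero have "\<forall>n\<ge>k. lift_V (act V (Poly_Mapping.single (K (int n)) 1)) (pure u v) \<in> R"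
      by simp
    then show "pure u v \<in> S" unfolding S_def by blast
  qed
  with f show ?thesis by (auto simp: S_def)
qed

lemma Act_asymptotic:
  assumes V: "bms_restricted V" and f: "f \<in> free" and K: "K \<in> gen_kinds"
  shows "\<exists>k. \<forall>n\<ge>k. Act (Poly_Mapping.single (K (int n)) 1) f
    \<simeq> (\<Sum>i\<in>A. pm_scale (l i ^ n) (lift i (op i (K (int n))) f))"
proof -
  obtain k where k: "\<And>n. n \<ge> k \<Longrightarrow> lift_V (act V (Poly_Mapping.single (K (int n)) 1)) f \<in> R"
    using lift_V_restricted[OF V f K] by blast
  have "Act (Poly_Mapping.single (K (int n)) 1) f
    \<simeq> (\<Sum>i\<in>A. pm_scale (l i ^ n) (lift i (op i (K (int n))) f)) + 0" if "n \<ge> k" for n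
    unfolding Act_eq
    using lift_act[OF _ f K, of _ "int n"] k[OF that]
    by (intro eqv_add eqv_sum) (simp_all add: eqv_0_iff)
  then show ?thesis by auto
qed

text \<open>W_0 puts t into the slot, and t takes the value 1 at the evaluation point, so
  \<open>ev\<close> still returns v. It shows that every slot leaves a nonzero trace on 1 \<otimes>
  v.\<close>

lemma lift_t_pure_ones:
  assumes "i \<in> A" "v \<in> carrier V" "lift i (op i (Wgen 0)) (pure ones v) \<in> R"
  shows "v = \<zero>\<^bsub>V\<^esub>"
proof -
  have "(ones(i := [:[:0, 1:]:]), v) \<in> gens"
    using assms by (intro gens_fun_upd) simp_all
  then have "ev (pure (ones(i := [:[:0, 1:]:])) v) = v"
    using assms(1,2)
    by (simp add: ev_pure prod_ev_fun_upd V.smult_one[simplified] del: fun_upd_apply)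
       (simp add: ones_def ev_poly_simps ev_poly_def[of "[:[:0, 1:]:]"] V.smult_one[simplified])
  moreover have "lift i (op i (Wgen 0)) (pure ones v) = pure (ones(i := [:[:0, 1:]:])) v"
    using assms(1) by (simp add: Phi_gen_act_0 ones_def)
  ultimately show ?thesis using ev_R[OF assms(3)] by simp
qed

lemma pure_ones_not_R: "v \<in> carrier V \<Longrightarrow> pure ones v \<in> R \<Longrightarrow> v = \<zero>\<^bsub>V\<^esub>"
  using ev_R ev_pure_ones by fastforce

end

locale phi_tensor_pair =
  T: phi_tensor A l \<alpha> \<beta> \<gamma> h V + T': phi_tensor A' l' \<alpha>' \<beta>' \<gamma>' h' V'
  for A :: "'i set" and l \<alpha> \<beta> \<gamma> h and V :: "'v bms_mod"
    and A' :: "'j set" and l' \<alpha>' \<beta>' \<gamma>' h' and V' :: "'w bms_mod"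

text \<open>An isomorphism of the quotients, described by a linear map of the free spaces inducing
  it: \<open>\<phi>_R_iff\<close> expresses well-definedness and injectivity,
  \<open>\<phi>_surj\<close> surjectivity.\<close>

locale phi_tensor_iso = phi_tensor_pair A l \<alpha> \<beta> \<gamma> h V A' l' \<alpha>' \<beta>' \<gamma>' h' V'
  for A :: "'i set" and l \<alpha> \<beta> \<gamma> h and V :: "'v bms_mod"
    and A' :: "'j set" and l' \<alpha>' \<beta>' \<gamma>' h' and V' :: "'w bms_mod" +
  fixes \<phi> :: "(('i \<Rightarrow> complex poly poly) \<times> 'v \<Rightarrow>\<^sub>0 complex) \<Rightarrow>
    (('j \<Rightarrow> complex poly poly) \<times> 'w \<Rightarrow>\<^sub>0 complex)"
  assumes l_nz: "\<And>i. i \<in> A \<Longrightarrow> l i \<noteq> 0" and l'_nz: "\<And>j. j \<in> A' \<Longrightarrow> l' j \<noteq> 0"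
    and \<alpha>\<beta>: "\<And>i. i \<in> A \<Longrightarrow> \<alpha> i \<noteq> 0 \<or> \<beta> i \<noteq> 0"
    and inj_l: "inj_on l A" and inj_l': "inj_on l' A'"
    and restricted: "bms_restricted V" "bms_restricted V'"
    and irreducible: "bms_irreducible V" "bms_irreducible V'"
    and linear_\<phi>: "pm_linear \<phi>"
    and \<phi>_free: "\<And>f. f \<in> T.free \<Longrightarrow> \<phi> f \<in> T'.free"
    and \<phi>_R_iff: "\<And>f. f \<in> T.free \<Longrightarrow> \<phi> f \<in> T'.R \<longleftrightarrow> f \<in> T.R"
    and \<phi>_surj: "\<And>f'. f' \<in> T'.free \<Longrightarrow> \<exists>f\<in>T.free. T'.eqv (\<phi> f) f'"
    and \<phi>_Act: "\<And>x f. f \<in> T.free \<Longrightarrow> T'.eqv (\<phi> (T.Act x f)) (T'.Act x (\<phi> f))"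
begin

lemmas \<phi>_simps = pm_linear_simps[OF linear_\<phi>]

lemma \<phi>_R: "f \<in> T.R \<Longrightarrow> \<phi> f \<in> T'.R"
  using \<phi>_R_iff T.R_subset_free by blast

lemma \<phi>_eqv: "T.eqv f g \<Longrightarrow> T'.eqv (\<phi> f) (\<phi> g)"
  using \<phi>_R[of "f - g"] by (simp add: T.eqv_def T'.eqv_def \<phi>_simps)

lemma obtain_nonzero: obtains v where "v \<in> carrier V" "v \<noteq> \<zero>\<^bsub>V\<^esub>"
  using irreducible(1) T.V.zero_closed unfolding bms_irreducible_def by blast

lemma obtain_nonzero': obtains v where "v \<in> carrier V'" "v \<noteq> \<zero>\<^bsub>V'\<^esub>"
  using irreducible(2) T'.V.zero_closed unfolding bms_irreducible_def by blast

text \<open>The sums run over all slots with value \<mu>, so a \<mu> present on one side only is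
  covered too, with an empty sum opposite; \<open>image_l\<close> rules that case out.\<close>

lemma eigen_component:
  assumes f: "f \<in> T.free" and K: "K \<in> gen_kinds" and \<mu>: "\<mu> \<in> l ` A \<union> l' ` A'"
  shows "T'.eqv (\<phi> (\<Sum>i | i \<in> A \<and> l i = \<mu>. T.lift i (T.op i (K n)) f))
    (\<Sum>j | j \<in> A' \<and> l' j = \<mu>. T'.lift j (T'.op j (K n)) (\<phi> f))"
proof -
  define a where "a \<mu> n = \<phi> (\<Sum>i | i \<in> A \<and> l i = \<mu>. T.lift i (T.op i (K n)) f)
    - (\<Sum>j | j \<in> A' \<and> l' j = \<mu>. T'.lift j (T'.op j (K n)) (\<phi> f))" for \<mu> n
  define S where "S = l ` A \<union> l' ` A'"
  have S: "finite S" "0 \<notin> S"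
    using T.finite_A T'.finite_A l_nz l'_nz by (auto simp: S_def)
  obtain k where k: "\<And>n. n \<ge> k \<Longrightarrow> T.eqv (T.Act (Poly_Mapping.single (K (int n)) 1) f)
      (\<Sum>i\<in>A. pm_scale (l i ^ n) (T.lift i (T.op i (K (int n))) f))"
    using T.Act_asymptotic[OF restricted(1) f K] by blast
  obtain k' where k': "\<And>n. n \<ge> k' \<Longrightarrow> T'.eqv (T'.Act (Poly_Mapping.single (K (int n)) 1) (\<phi> f))
      (\<Sum>j\<in>A'. pm_scale (l' j ^ n) (T'.lift j (T'.op j (K (int n))) (\<phi> f)))"
    using T'.Act_asymptotic[OF restricted(2) \<phi>_free[OF f] K] by blast
  have "a \<mu> n \<in> T'.R" if "\<mu> \<in> S" for \<mu> n
  proof (rule pmc.exp_poly_seq_mem[OF T'.subspace_R S _ _ that])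
    show "pmc.poly_seq T'.R (a \<mu>)" for \<mu>
      unfolding a_def \<phi>_simps
    proof (intro pmc.poly_seq_diff pmc.poly_seq_sum T'.subspace_R)
      fix i assume "i \<in> {i \<in> A. l i = \<mu>}"
      then have "pmc.poly_seq T.R (\<lambda>n. T.lift i (T.op i (K n)) f)"
        using f K by (intro T.lift_poly_seq poly_seq_Phi_gen_act) simp_all
      then show "pmc.poly_seq T'.R (\<lambda>n. \<phi> (T.lift i (T.op i (K n)) f))"
        by (rule pmc.poly_seq_linear_mod[OF T.subspace_R T'.subspace_R pm.vector_space_axioms, rotated 3])
           (simp_all add: \<phi>_simps \<phi>_R pm.subspace_0)
    next
      fix j assume "j \<in> {j \<in> A'. l' j = \<mu>}"
      then show "pmc.poly_seq T'.R (\<lambda>n. T'.lift j (T'.op j (K n)) (\<phi> f))"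
        using \<phi>_free[OF f] K by (intro T'.lift_poly_seq poly_seq_Phi_gen_act) simp_all
    qed
    fix n assume n: "n \<ge> max k k'"
    have "(\<Sum>\<mu>\<in>S. pm_scale (\<mu> ^ n) (a \<mu> (int n)))
        = (\<Sum>\<mu>\<in>S. \<Sum>i | i \<in> A \<and> l i = \<mu>. pm_scale (l i ^ n) (\<phi> (T.lift i (T.op i (K (int n))) f)))
          - (\<Sum>\<mu>\<in>S. \<Sum>j | j \<in> A' \<and> l' j = \<mu>. pm_scale (l' j ^ n) (T'.lift j (T'.op j (K (int n))) (\<phi> f)))"
      by (simp add: a_def \<phi>_simps pm.scale_right_diff_distrib pm.scale_sum_right sum_subtractf)
    \<comment> \<open>Regrouping by the values of \<open>l\<close> and \<open>l'\<close> restores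
      the full sums, since S contains both images.\<close>
    also have "\<dots> = \<phi> (\<Sum>i\<in>A. pm_scale (l i ^ n) (T.lift i (T.op i (K (int n))) f))
          - (\<Sum>j\<in>A'. pm_scale (l' j ^ n) (T'.lift j (T'.op j (K (int n))) (\<phi> f)))"
      using T.finite_A T'.finite_A
      by (subst (1 2) sum.group) (auto simp: S_def \<phi>_simps)
    finally have eq: "(\<Sum>\<mu>\<in>S. pm_scale (\<mu> ^ n) (a \<mu> (int n)))
        = \<phi> (\<Sum>i\<in>A. pm_scale (l i ^ n) (T.lift i (T.op i (K (int n))) f))
          - (\<Sum>j\<in>A'. pm_scale (l' j ^ n) (T'.lift j (T'.op j (K (int n))) (\<phi> f)))" .
    have "T'.eqv (\<phi> (\<Sum>i\<in>A. pm_scale (l i ^ n) (T.lift i (T.op i (K (int n))) f)))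
        (\<phi> (T.Act (Poly_Mapping.single (K (int n)) 1) f))"
      using n by (intro \<phi>_eqv T.eqv_sym[OF k]) simp
    also note \<phi>_Act[OF f]
    also have "T'.eqv (T'.Act (Poly_Mapping.single (K (int n)) 1) (\<phi> f))
        (\<Sum>j\<in>A'. pm_scale (l' j ^ n) (T'.lift j (T'.op j (K (int n))) (\<phi> f)))"
      using n by (intro k') simp
    finally show "(\<Sum>\<mu>\<in>S. pm_scale (\<mu> ^ n) (a \<mu> (int n))) \<in> T'.R"
      unfolding eq by (simp add: T'.eqv_def)
  qed
  with \<mu> show ?thesis by (simp add: a_def S_def T'.eqv_def)
qed

text \<open>If \<mu> occurred on one side only, W_0 in its slot would send 1 \<otimes> v to zero,
  against \<open>lift_t_pure_ones\<close>.\<close>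

lemma image_l: "l ` A = l' ` A'"
proof (intro equalityI subsetI)
  fix \<mu> assume "\<mu> \<in> l ` A"
  then obtain i where i: "i \<in> A" "\<mu> = l i" by blast
  have Ai: "{i' \<in> A. l i' = \<mu>} = {i}"
    using i inj_l by (auto dest: inj_onD)
  obtain v where v: "v \<in> carrier V" "v \<noteq> \<zero>\<^bsub>V\<^esub>" by (rule obtain_nonzero)
  show "\<mu> \<in> l' ` A'"
  proof (rule ccontr)
    assume "\<mu> \<notin> l' ` A'"
    then have none: "{j \<in> A'. l' j = \<mu>} = {}" by auto
    have "\<phi> (T.lift i (T.op i (Wgen 0)) (pure T.ones v)) \<in> T'.R"
      using eigen_component[of "pure T.ones v" Wgen \<mu> 0, unfolded Ai none] i v
      by (simp add: T'.eqv_def gen_kinds_def del: T.lift_pure Phi_gen_act.simps)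
    then have "T.lift i (T.op i (Wgen 0)) (pure T.ones v) \<in> T.R"
      using i v by (subst (asm) \<phi>_R_iff) (auto intro: T.lift_free)
    with i v show False using T.lift_t_pure_ones by blast
  qed
next
  fix \<mu> assume "\<mu> \<in> l' ` A'"
  then obtain j where j: "j \<in> A'" "\<mu> = l' j" by blast
  have Aj: "{j' \<in> A'. l' j' = \<mu>} = {j}"
    using j inj_l' by (auto dest: inj_onD)
  obtain v where v: "v \<in> carrier V'" "v \<noteq> \<zero>\<^bsub>V'\<^esub>" by (rule obtain_nonzero')
  \<comment> \<open>As \<phi> goes one way only, 1 \<otimes> v in the second product is reached
    through a preimage modulo relators.\<close>
  obtain f where f: "f \<in> T.free" "T'.eqv (\<phi> f) (pure T'.ones v)"
    using \<phi>_surj[of "pure T'.ones v"] v by auto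
  show "\<mu> \<in> l ` A"
  proof (rule ccontr)
    assume "\<mu> \<notin> l ` A"
    then have none: "{i \<in> A. l i = \<mu>} = {}" by auto
    have "T'.eqv 0 (T'.lift j (T'.op j (Wgen 0)) (\<phi> f))"
      using eigen_component[of f Wgen \<mu> 0, unfolded Aj none] j f
      by (simp add: gen_kinds_def \<phi>_simps del: Phi_gen_act.simps)
    then have "T'.eqv (T'.lift j (T'.op j (Wgen 0)) (\<phi> f)) 0"
      by (rule T'.eqv_sym)
    then have "T'.eqv (T'.lift j (T'.op j (Wgen 0)) (pure T'.ones v)) 0"
      using T'.lift_eqv[OF j(1) clinear_Phi_gen_act T'.eqv_sym[OF f(2)]] T'.eqv_trans by blast
    with j v show False using T'.lift_t_pure_ones unfolding T'.eqv_0_iff by blast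
  qed
qed

lemma intertwine:
  assumes i: "i \<in> A" and j: "j \<in> A'" and ij: "l i = l' j" and f: "f \<in> T.free" and K: "K \<in> gen_kinds"
  shows "T'.eqv (\<phi> (T.lift i (T.op i (K n)) f)) (T'.lift j (T'.op j (K n)) (\<phi> f))"
proof -
  have "i' = i" if "i' \<in> A" "l i' = l i" for i'
    using inj_onD[OF inj_l that(2,1) i] .
  then have "{i' \<in> A. l i' = l i} = {i}" using i by blast
  moreover have "j' = j" if "j' \<in> A'" "l' j' = l i" for j'
    using inj_onD[OF inj_l' that(2)[unfolded ij] that(1) j] .
  then have "{j' \<in> A'. l' j' = l i} = {j}" using j ij by auto
  ultimately show ?thesis
    using eigen_component[OF f K, of "l i" n] i by simp
qed

text \<open>The polynomials q with this property form a subalgebra; it contains s and t by the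
  operators at index 0, and the constants by linearity.\<close>

lemma intertwine_mult:
  assumes i: "i \<in> A" and j: "j \<in> A'" and ij: "l i = l' j" and f: "f \<in> T.free"
  shows "T'.eqv (\<phi> (T.lift i ((*) q) f)) (T'.lift j ((*) q) (\<phi> f))"
proof -
  define G where "G q \<longleftrightarrow> (\<forall>f\<in>T.free. T'.eqv (\<phi> (T.lift i ((*) q) f)) (T'.lift j ((*) q) (\<phi> f)))" for q
  have G_s: "G [:0, 1:]"
    unfolding G_def
    using intertwine[OF i j ij, of _ Lgen 0] by (simp add: gen_kinds_def Phi_gen_act_0)
  have G_t: "G [:[:0, 1:]:]"
    unfolding G_def
    using intertwine[OF i j ij, of _ Wgen 0] by (simp add: gen_kinds_def Phi_gen_act_0)
  have G_const: "G [:[:c:]:]" for c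
    unfolding G_def
  proof
    fix f assume f: "f \<in> T.free"
    have c: "(*) [:[:c:]:] = (\<lambda>x. cscale c x)" by (simp add: cscale_def fun_eq_iff)
    have "T'.eqv (\<phi> (T.lift i ((*) [:[:c:]:]) f)) (pm_scale c (\<phi> f))"
      using \<phi>_eqv[OF T.lift_scale[OF i f, of c "\<lambda>x. x"]] by (simp add: c \<phi>_simps T.lift_id)
    moreover have "T'.eqv (T'.lift j ((*) [:[:c:]:]) (\<phi> f)) (pm_scale c (\<phi> f))"
      using T'.lift_scale[OF j \<phi>_free[OF f], of c "\<lambda>x. x"] by (simp add: c T'.lift_id)
    ultimately show "T'.eqv (\<phi> (T.lift i ((*) [:[:c:]:]) f)) (T'.lift j ((*) [:[:c:]:]) (\<phi> f))"
      using T'.eqv_trans T'.eqv_sym by blast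
  qed
  have G_add: "G (p + q)" if "G p" "G q" for p q
    unfolding G_def
  proof
    fix f assume f: "f \<in> T.free"
    have "T'.eqv (\<phi> (T.lift i ((*) (p + q)) f)) (\<phi> (T.lift i ((*) p) f) + \<phi> (T.lift i ((*) q) f))"
      using \<phi>_eqv[OF T.lift_add[OF i f]] by (simp add: \<phi>_simps distrib_right[abs_def])
    also have "T'.eqv \<dots> (T'.lift j ((*) p) (\<phi> f) + T'.lift j ((*) q) (\<phi> f))"
      using that f by (intro T'.eqv_add) (auto simp: G_def)
    also have "T'.eqv \<dots> (T'.lift j ((*) (p + q)) (\<phi> f))"
      using T'.eqv_sym[OF T'.lift_add[OF j \<phi>_free[OF f]]] by (simp add: distrib_right[abs_def])
    finally show "T'.eqv (\<phi> (T.lift i ((*) (p + q)) f)) (T'.lift j ((*) (p + q)) (\<phi> f))" .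
  qed
  have G_mult: "G (p * q)" if "G p" "G q" for p q
    unfolding G_def
  proof
    fix f assume f: "f \<in> T.free"
    have pq: "(*) (p * q) = (*) p \<circ> (*) q" by (simp add: fun_eq_iff mult.assoc)
    have "T'.eqv (\<phi> (T.lift i ((*) p) (T.lift i ((*) q) f))) (T'.lift j ((*) p) (\<phi> (T.lift i ((*) q) f)))"
      using that(1) T.lift_free[OF f i] by (simp add: G_def)
    also have "T'.eqv \<dots> (T'.lift j ((*) p) (T'.lift j ((*) q) (\<phi> f)))"
      using that(2) f by (intro T'.lift_eqv[OF j clinear_mult]) (simp add: G_def)
    finally show "T'.eqv (\<phi> (T.lift i ((*) (p * q)) f)) (T'.lift j ((*) (p * q)) (\<phi> f))"
      by (simp only: pq T.lift_comp T'.lift_comp)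
  qed
  have G_t_poly: "G [:p:]" for p
  proof (induction p)
    case 0
    show ?case using G_const[of 0] by simp
  next
    case (pCons c p)
    have "[:pCons c p:] = [:[:c:]:] + [:[:0, 1:]:] * [:p:]" by simp
    then show ?case using G_add[OF G_const G_mult[OF G_t pCons.IH]] by simp
  qed
  have "G q"
  proof (induction q)
    case 0
    show ?case using G_t_poly[of 0] by simp
  next
    case (pCons p q)
    have "pCons p q = [:p:] + [:0, 1:] * q" by simp
    then show ?case using G_add[OF G_t_poly G_mult[OF G_s pCons.IH]] by simp
  qed
  with f show ?thesis by (simp add: G_def)
qed

section \<open>Operators annihilating the image of 1 \<otimes> v\<close>

definition rel_ops :: "'i \<Rightarrow> 'j \<Rightarrow> (complex poly poly \<Rightarrow> complex poly poly) list" where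
  "rel_ops i j = map (\<lambda>a x. T.op i a 1 * x - T'.op j a x) [Wgen 1, Jgen 0, Igen 0, Igen 1, Lgen 1, Lgen 2]"

lemma slot_kernel:
  assumes i: "i \<in> A" and j: "j \<in> A'" and ij: "l i = l' j" and v: "v \<in> carrier V"
    and B: "clinear B" and ker: "\<And>f. (\<And>D. D \<in> set (rel_ops i j) \<Longrightarrow> D f = 0) \<Longrightarrow> B f = 0"
  shows "T'.lift j B (\<phi> (pure T.ones v)) \<in> T'.R"
proof -
  define P where "P = \<phi> (pure T.ones v)"
  have P: "P \<in> T'.free" using v by (simp add: P_def \<phi>_free)
  have lin: "clinear (\<lambda>x. q * x - T'.op j a x)" for q a
    by (rule clinearI)
       (simp_all only: T.clinear_simps[OF clinear_Phi_gen_act] distrib_left cscale_mult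
         cs.scale_right_diff_distrib add_diff_add)
  have ann: "T'.lift j (\<lambda>x. T.op i a 1 * x - T'.op j a x) P \<in> T'.R" for a
  proof -
    obtain K n where a: "a = K n" "K \<in> gen_kinds" by (rule bms_gen_cases)
    \<comment> \<open>On a slot holding 1 the operator acts as multiplication by its value at 1.
      Both descriptions can be transported by \<phi>, and comparing the results gives the
      annihilator.\<close>
    have 1: "T.lift i (T.op i a) (pure T.ones v) = T.lift i ((*) (T.op i a 1)) (pure T.ones v)"
      using i by (simp only: T.lift_pure) (simp only: T.ones_def restrict_apply' mult_1_right)
    have 2: "T'.eqv (\<phi> (T.lift i (T.op i a) (pure T.ones v))) (T'.lift j (T'.op j a) P)"
      unfolding P_def a(1) using v by (intro intertwine[OF i j ij _ a(2)]) simp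
    have 3: "T'.eqv (\<phi> (T.lift i ((*) (T.op i a 1)) (pure T.ones v))) (T'.lift j ((*) (T.op i a 1)) P)"
      unfolding P_def using v by (intro intertwine_mult[OF i j ij]) simp
    have "T'.eqv (T'.lift j ((*) (T.op i a 1)) P) (T'.lift j (T'.op j a) P)"
      by (rule T'.eqv_trans[OF T'.eqv_sym[OF 3] 2[unfolded 1]])
    then have "T'.lift j ((*) (T.op i a 1)) P - T'.lift j (T'.op j a) P \<in> T'.R"
      by (simp add: T'.eqv_def)
    moreover have "T'.eqv (T'.lift j (\<lambda>x. T.op i a 1 * x - T'.op j a x) P)
        (T'.lift j ((*) (T.op i a 1)) P - T'.lift j (T'.op j a) P)"
      by (rule T'.lift_diff[OF j P])
    ultimately show ?thesis
      using T'.eqv_trans unfolding T'.eqv_0_iff[symmetric] by blast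
  qed
  show ?thesis
    unfolding P_def[symmetric]
  proof (rule csc.annihilator_kernel[where \<rho> = "T'.lift j" and As = "rel_ops i j"])
    show "T'.lift j (\<lambda>x. A x + B x) P - (T'.lift j A P + T'.lift j B P) \<in> T'.R" for A B
      using T'.lift_add[OF j P] by (simp add: T'.eqv_def)
    show "T'.lift j (\<lambda>_. 0) P \<in> T'.R" by (rule T'.lift_zero[OF j P])
    show "clinear D" if "D \<in> set (rel_ops i j)" for D
      using that unfolding rel_ops_def set_map by (elim imageE) (simp only: lin)
    show "T'.lift j D P \<in> T'.R" if "D \<in> set (rel_ops i j)" for D
      using that unfolding rel_ops_def set_map by (elim imageE) (simp only: ann)
  qed (use B ker in \<open>auto simp: T'.lift_comp T'.lift_R j pm.subspace_add\<close>)
qed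

text \<open>The six generators in \<open>rel_ops\<close> are exactly those from which
  \<open>Phi_hom_generator\<close> draws its conclusion: W_1 fixes \<alpha> and removes s, J_0 and
  I_0 fix \<beta> and \<gamma>, and the other three settle h and the dependence on t.\<close>

lemma rel_ops_kernel:
  assumes i: "i \<in> A" and f: "f \<noteq> 0" "\<And>D. D \<in> set (rel_ops i j) \<Longrightarrow> D f = 0"
  shows "\<alpha> i = \<alpha>' j \<and> \<beta> i = \<beta>' j \<and> \<gamma> i = \<gamma>' j \<and> h i = h' j \<and> (\<exists>c. f = [:[:c:]:])"
proof (rule Phi_hom_generator[OF f(1) \<alpha>\<beta>[OF i]])
  fix a assume "a \<in> {Wgen 1, Jgen 0, Igen 0, Igen 1, Lgen 1, Lgen 2}"
  then have "(\<lambda>x. T.op i a 1 * x - T'.op j a x) \<in> set (rel_ops i j)"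
    unfolding rel_ops_def by auto
  from f(2)[OF this] show "T.op i a 1 * f = T'.op j a f" by simp
qed

lemma parameters_eq:
  assumes i: "i \<in> A" and j: "j \<in> A'" and ij: "l i = l' j"
  shows "\<alpha> i = \<alpha>' j \<and> \<beta> i = \<beta>' j \<and> \<gamma> i = \<gamma>' j \<and> h i = h' j"
proof -
  obtain v where v: "v \<in> carrier V" "v \<noteq> \<zero>\<^bsub>V\<^esub>" by (rule obtain_nonzero)
  then have "pure T.ones v \<notin> T.R" using T.pure_ones_not_R by blast
  then have "\<phi> (pure T.ones v) \<notin> T'.R" using v by (simp add: \<phi>_R_iff)
  then have "T'.lift j (\<lambda>x. x) (\<phi> (pure T.ones v)) \<notin> T'.R" by (simp add: T'.lift_id)
  moreover have "clinear (\<lambda>x. x)" by (rule clinearI) simp_all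
  \<comment> \<open>Were the common kernel zero, \<open>slot_kernel\<close> for the identity would
    place the image of 1 \<otimes> v in the span of the relators.\<close>
  ultimately obtain f where f: "f \<noteq> 0" "\<And>D. D \<in> set (rel_ops i j) \<Longrightarrow> D f = 0"
    using slot_kernel[OF i j ij v(1), of "\<lambda>x. x"] by blast
  from rel_ops_kernel[OF i f(1), of j] f(2) show ?thesis by blast
qed

text \<open>The map const_part - id vanishes on the common kernel, which consists of constants, so
  \<open>slot_kernel\<close> applies to it.\<close>

lemma \<phi>_pure_ones_const:
  assumes j: "j \<in> A'" and v: "v \<in> carrier V"
  shows "T'.eqv (T'.lift j const_part (\<phi> (pure T.ones v))) (\<phi> (pure T.ones v))"
proof -
  from j image_l obtain i where i: "i \<in> A" "l i = l' j" by (metis imageE imageI)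
  have "T'.lift j (\<lambda>x. const_part x - x) (\<phi> (pure T.ones v)) \<in> T'.R"
  proof (rule slot_kernel[OF i(1) j i(2) v])
    show "clinear (\<lambda>x. const_part x - x)"
      by (rule clinearI)
         (simp_all only: T.clinear_simps[OF clinear_const_part] add_diff_add cs.scale_right_diff_distrib)
    fix f assume D: "\<And>D. D \<in> set (rel_ops i j) \<Longrightarrow> D f = 0"
    have "const_part [:[:c:]:] = [:[:c:]:]" for c
      by (simp add: const_part_def ev_poly_def cscale_def one_pCons)
    moreover have "f = [:[:0:]:] \<or> (\<exists>c. f = [:[:c:]:])"
      using rel_ops_kernel[OF i(1), of f j] D by auto
    ultimately show "const_part f - f = 0" by (metis diff_self)
  qed
  moreover have "T'.eqv (T'.lift j (\<lambda>x. const_part x - x) (\<phi> (pure T.ones v)))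
      (T'.lift j const_part (\<phi> (pure T.ones v)) - T'.lift j (\<lambda>x. x) (\<phi> (pure T.ones v)))"
    using v by (intro T'.lift_diff[OF j] \<phi>_free) simp
  ultimately have "T'.eqv (T'.lift j const_part (\<phi> (pure T.ones v)) - T'.lift j (\<lambda>x. x) (\<phi> (pure T.ones v))) 0"
    unfolding T'.eqv_0_iff[symmetric] using T'.eqv_sym T'.eqv_trans by blast
  then show ?thesis by (simp add: T'.eqv_def T'.lift_id)
qed

section \<open>The induced map from V to V'\<close>

definition \<psi> :: "'v \<Rightarrow> 'w" where
  "\<psi> v = T'.ev (\<phi> (pure T.ones v))"

lemma \<psi>_closed: "\<psi> v \<in> carrier V'"
  by (simp add: \<psi>_def T'.ev_closed)

lemma \<phi>_pure_ones: "v \<in> carrier V \<Longrightarrow> T'.eqv (\<phi> (pure T.ones v)) (pure T'.ones (\<psi> v))"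
  unfolding \<psi>_def by (rule T'.const_part_eqv_pure_ones) (simp_all add: \<phi>_free \<phi>_pure_ones_const)

definition \<tau> :: "'i \<Rightarrow> 'j" where
  "\<tau> i = inv_into A' l' (l i)"

lemma \<tau>: "i \<in> A \<Longrightarrow> \<tau> i \<in> A'" "i \<in> A \<Longrightarrow> l' (\<tau> i) = l i"
  using image_l by (metis \<tau>_def imageI inv_into_into) (metis \<tau>_def imageI f_inv_into_f image_l)

lemma bij_\<tau>: "bij_betw \<tau> A A'"
proof (rule bij_betw_imageI)
  show "inj_on \<tau> A" using inj_l \<tau>(2) by (metis inj_on_def)
  show "\<tau> ` A = A'"
  proof (intro equalityI subsetI)
    fix j assume j: "j \<in> A'"
    then obtain i where i: "i \<in> A" "l i = l' j" using image_l by (metis imageE imageI)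
    then have "\<tau> i = j" using \<tau>[OF i(1)] j inj_l' by (metis inj_onD)
    with i show "j \<in> \<tau> ` A" by blast
  qed (use \<tau>(1) in auto)
qed

text \<open>The action on V is the full action minus that of the slots, and slots with equal
  \<lambda> are already intertwined at every integer index.\<close>

lemma intertwine_V:
  fixes n :: int
  assumes f: "f \<in> T.free" and K: "K \<in> gen_kinds"
  defines "x \<equiv> Poly_Mapping.single (K n) 1"
  shows "T'.eqv (\<phi> (T.lift_V (act V x) f)) (T'.lift_V (act V' x) (\<phi> f))"
proof -
  have slot: "T'.eqv (\<phi> (T.lift i (act (T.M i) x) f)) (T'.lift (\<tau> i) (act (T'.M (\<tau> i)) x) (\<phi> f))"
    if i: "i \<in> A" for i
  proof -
    have "T'.eqv (\<phi> (T.lift i (act (T.M i) x) f)) (pm_scale (l i powi n) (\<phi> (T.lift i (T.op i (K n)) f)))"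
      using \<phi>_eqv[OF T.lift_act[OF i f K]] by (simp only: \<phi>_simps x_def)
    also have "T'.eqv \<dots> (pm_scale (l i powi n) (T'.lift (\<tau> i) (T'.op (\<tau> i) (K n)) (\<phi> f)))"
      by (intro T'.eqv_scale intertwine f K i \<tau> \<tau>(2)[symmetric])
    also have "T'.eqv \<dots> (T'.lift (\<tau> i) (act (T'.M (\<tau> i)) x) (\<phi> f))"
      using T'.eqv_sym[OF T'.lift_act[OF \<tau>(1)[OF i] \<phi>_free[OF f] K, of n]] \<tau>(2)[OF i]
      by (simp only: x_def)
    finally show ?thesis .
  qed
  have "T'.eqv (\<phi> (T.Act x f) - (\<Sum>i\<in>A. \<phi> (T.lift i (act (T.M i) x) f)))
      (T'.Act x (\<phi> f) - (\<Sum>i\<in>A. T'.lift (\<tau> i) (act (T'.M (\<tau> i)) x) (\<phi> f)))"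
    by (intro T'.eqv_diff T'.eqv_sum slot \<phi>_Act f)
  moreover have "(\<Sum>i\<in>A. T'.lift (\<tau> i) (act (T'.M (\<tau> i)) x) (\<phi> f))
      = (\<Sum>j\<in>A'. T'.lift j (act (T'.M j) x) (\<phi> f))"
    by (rule sum.reindex_bij_betw[OF bij_\<tau>])
  ultimately show ?thesis by (simp add: T.Act_eq T'.Act_eq \<phi>_simps)
qed

lemma \<psi>_add:
  assumes "v \<in> carrier V" "w \<in> carrier V"
  shows "\<psi> (v \<oplus>\<^bsub>V\<^esub> w) = \<psi> v \<oplus>\<^bsub>V'\<^esub> \<psi> w"
proof -
  have "T.eqv (pure T.ones (v \<oplus>\<^bsub>V\<^esub> w)) (pure T.ones v + pure T.ones w)"
    using T.rel_add[of T.ones v w] assms by (simp add: T.eqv_def diff_diff_add)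
  from T'.ev_eqv[OF \<phi>_eqv[OF this]] show ?thesis by (simp add: \<psi>_def \<phi>_simps T'.ev_add)
qed

lemma \<psi>_scale:
  assumes "v \<in> carrier V"
  shows "\<psi> (c \<odot>\<^bsub>V\<^esub> v) = c \<odot>\<^bsub>V'\<^esub> \<psi> v"
proof -
  have "T.eqv (pure T.ones (c \<odot>\<^bsub>V\<^esub> v)) (pm_scale c (pure T.ones v))"
    using T.rel_scale[of T.ones v c] assms by (simp add: T.eqv_def)
  from T'.ev_eqv[OF \<phi>_eqv[OF this]] show ?thesis by (simp add: \<psi>_def \<phi>_simps T'.ev_scale)
qed

lemma \<psi>_act_gen:
  fixes a :: bms_gen
  assumes v: "v \<in> carrier V"
  defines "x \<equiv> Poly_Mapping.single a 1"
  shows "\<psi> (act V x v) = act V' x (\<psi> v)"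
proof -
  obtain K n where a: "a = K n" "K \<in> gen_kinds" by (rule bms_gen_cases)
  have "T'.eqv (\<phi> (T.lift_V (act V x) (pure T.ones v))) (T'.lift_V (act V' x) (\<phi> (pure T.ones v)))"
    unfolding x_def a(1) using v a(2) by (intro intertwine_V) simp_all
  also have "T'.eqv \<dots> (T'.lift_V (act V' x) (pure T'.ones (\<psi> v)))"
    using T'.lift_V_act_R[OF \<phi>_pure_ones[OF v, unfolded T'.eqv_def]]
    by (simp only: T'.eqv_def T'.lift_V_linear_simps)
  finally show ?thesis
    using T'.ev_eqv v by (fastforce simp: \<psi>_def[symmetric] T'.ev_pure_ones T'.V.act_closed \<psi>_closed)
qed

lemma \<psi>_zero: "\<psi> \<zero>\<^bsub>V\<^esub> = \<zero>\<^bsub>V'\<^esub>"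
  using \<psi>_scale[of "\<zero>\<^bsub>V\<^esub>" 0] T.V.smult_l_null[of "\<zero>\<^bsub>V\<^esub>"] T'.V.smult_l_null[OF \<psi>_closed] by simp

lemma \<psi>_act:
  assumes v: "v \<in> carrier V"
  shows "\<psi> (act V x v) = act V' x (\<psi> v)"
proof -
  have zero: "act V 0 v = \<zero>\<^bsub>V\<^esub>" "act V' 0 (\<psi> v) = \<zero>\<^bsub>V'\<^esub>"
    using T.V.act_scale_left[OF v, of 0 0] T.V.smult_l_null[OF T.V.act_closed[OF v]]
      T'.V.act_scale_left[OF \<psi>_closed, of 0 0] T'.V.smult_l_null[OF T'.V.act_closed[OF \<psi>_closed]]
    by simp_all
  have "x \<in> {x. \<psi> (act V x v) = act V' x (\<psi> v)}"
  proof (rule pm_mem_subspace)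
    show "pm.subspace {x. \<psi> (act V x v) = act V' x (\<psi> v)}"
      using v by (intro pm.subspaceI)
        (simp_all add: zero \<psi>_zero T.V.act_add_left T'.V.act_add_left T.V.act_scale_left
          T'.V.act_scale_left T.V.act_closed \<psi>_closed \<psi>_add \<psi>_scale)
  qed (simp add: \<psi>_act_gen v)
  then show ?thesis by simp
qed

lemma inj_\<psi>: "inj_on \<psi> (carrier V)"
proof (rule inj_onI)
  fix v w assume v: "v \<in> carrier V" and w: "w \<in> carrier V" and eq: "\<psi> v = \<psi> w"
  have "T'.eqv (\<phi> (pure T.ones v)) (\<phi> (pure T.ones w))"
    using \<phi>_pure_ones[OF v] \<phi>_pure_ones[OF w] unfolding eq by (metis T'.eqv_sym T'.eqv_trans)
  then have "\<phi> (pure T.ones v - pure T.ones w) \<in> T'.R"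
    by (simp add: T'.eqv_def \<phi>_simps)
  then have "T.eqv (pure T.ones v) (pure T.ones w)"
    using v w by (simp add: \<phi>_R_iff T.eqv_def)
  from T.ev_eqv[OF this] v w show "v = w" by (simp add: T.ev_pure_ones)
qed

text \<open>The image of \<psi> is a submodule of V', nonzero because \<psi> is injective and V is
  nonzero; irreducibility of V' makes it everything.\<close>

lemma bms_iso_V: "bms_iso V V'"
proof -
  have "bms_submodule (\<psi> ` carrier V) V'"
    unfolding bms_submodule_def
  proof (intro conjI allI ballI)
    show "submodule (\<psi> ` carrier V) complex_ring V'"
    proof (rule T'.V.submoduleI)
      show "\<zero>\<^bsub>V'\<^esub> \<in> \<psi> ` carrier V"
        using \<psi>_zero T.V.zero_closed by (metis imageI)
      show "\<ominus>\<^bsub>V'\<^esub> w \<in> \<psi> ` carrier V" if "w \<in> \<psi> ` carrier V" for w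
      proof -
        from that obtain v where v: "v \<in> carrier V" "w = \<psi> v" by blast
        have "\<psi> (\<ominus>\<^bsub>V\<^esub> v) \<oplus>\<^bsub>V'\<^esub> \<psi> v = \<zero>\<^bsub>V'\<^esub>"
          using v \<psi>_add[of "\<ominus>\<^bsub>V\<^esub> v" v] by (simp add: T.V.l_neg \<psi>_zero)
        then have "\<ominus>\<^bsub>V'\<^esub> w = \<psi> (\<ominus>\<^bsub>V\<^esub> v)"
          unfolding v(2) by (intro T'.V.minus_equality \<psi>_closed)
        with v show ?thesis by simp
      qed
    qed (auto simp: \<psi>_closed simp flip: \<psi>_add \<psi>_scale)
    show "act V' x w \<in> \<psi> ` carrier V" if "w \<in> \<psi> ` carrier V" for x w
      using that T.V.act_closed by (auto simp flip: \<psi>_act)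
  qed
  then have "\<psi> ` carrier V = {\<zero>\<^bsub>V'\<^esub>} \<or> \<psi> ` carrier V = carrier V'"
    using irreducible(2) unfolding bms_irreducible_def by blast
  moreover have "\<psi> ` carrier V \<noteq> {\<zero>\<^bsub>V'\<^esub>}"
  proof
    assume "\<psi> ` carrier V = {\<zero>\<^bsub>V'\<^esub>}"
    moreover obtain v where "v \<in> carrier V" "v \<noteq> \<zero>\<^bsub>V\<^esub>" by (rule obtain_nonzero)
    ultimately show False
      using inj_\<psi> \<psi>_zero T.V.zero_closed by (metis imageI inj_onD singletonD)
  qed
  ultimately have "bij_betw \<psi> (carrier V) (carrier V')"
    using inj_\<psi> by (simp add: bij_betw_def)
  then show ?thesis
    unfolding bms_iso_def using \<psi>_add \<psi>_scale \<psi>_act by blast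
qed

end

section \<open>The quotient and relabelling of the factors\<close>

context phi_tensor
begin

abbreviation T :: "(('i \<Rightarrow> complex poly poly) \<times> 'v \<Rightarrow>\<^sub>0 complex) set bms_mod" where
  "T \<equiv> tensor_module A M V"

definition cls :: "(('i \<Rightarrow> complex poly poly) \<times> 'v \<Rightarrow>\<^sub>0 complex) \<Rightarrow>
    (('i \<Rightarrow> complex poly poly) \<times> 'v \<Rightarrow>\<^sub>0 complex) set" where
  "cls f = tensor_rel A M V `` {f}"

lemma tensor_rel_iff: "(f, g) \<in> tensor_rel A M V \<longleftrightarrow> f \<in> free \<and> g \<in> free \<and> f \<simeq> g"
  by (simp add: tensor_rel_def eqv_def R_def free_def)

lemma mem_cls: "g \<in> cls f \<longleftrightarrow> f \<in> free \<and> g \<in> free \<and> f \<simeq> g"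
  by (simp add: cls_def tensor_rel_iff)

lemma cls_eq_iff: "f \<in> free \<Longrightarrow> g \<in> free \<Longrightarrow> cls f = cls g \<longleftrightarrow> f \<simeq> g"
proof
  assume "f \<in> free" "g \<in> free" "cls f = cls g"
  then have "g \<in> cls f" by (simp add: mem_cls)
  then show "f \<simeq> g" by (simp add: mem_cls)
next
  assume fg: "f \<in> free" "g \<in> free" "f \<simeq> g"
  have "f \<simeq> k \<longleftrightarrow> g \<simeq> k" for k
    using eqv_trans[OF fg(3)] eqv_trans[OF eqv_sym[OF fg(3)]] by blast
  with fg show "cls f = cls g" by (simp add: set_eq_iff mem_cls)
qed

lemma cls_eqI: "f \<in> free \<Longrightarrow> g \<in> free \<Longrightarrow> f \<simeq> g \<Longrightarrow> cls g = cls f"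
  using cls_eq_iff[of f g] by simp

text \<open>The operations of \<open>tensor_module\<close> are unions over representatives; such a
  union collapses once its terms do not depend on the representative.\<close>

lemma UN_cls:
  assumes "f \<in> free" "\<And>g. g \<in> free \<Longrightarrow> f \<simeq> g \<Longrightarrow> H g = H f"
  shows "(\<Union>g\<in>cls f. H g) = H f"
proof -
  have "(\<Union>g\<in>cls f. H g) = (\<Union>g\<in>cls f. H f)"
  proof (rule SUP_cong[OF refl])
    fix g assume "g \<in> cls f"
    then show "H g = H f" by - (rule assms(2), simp_all add: mem_cls)
  qed
  moreover have "f \<in> cls f" using assms(1) by (simp add: mem_cls)
  ultimately show ?thesis by auto
qed

lemma carrier_T: "carrier T = cls ` free"
  by (auto simp: tensor_module_def quotient_def cls_def free_def)

lemma add_T: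
  assumes f: "f \<in> free" and g: "g \<in> free"
  shows "cls f \<oplus>\<^bsub>T\<^esub> cls g = cls (f + g)"
proof -
  have "(\<Union>g'\<in>cls g. cls (f' + g')) = cls (f' + g)" if "f' \<in> free" for f'
  proof (rule UN_cls[OF g])
    fix g' assume "g' \<in> free" "g \<simeq> g'"
    with that g show "cls (f' + g') = cls (f' + g)"
      by - (rule cls_eqI, simp_all add: eqv_add)
  qed
  then have "(\<Union>f'\<in>cls f. \<Union>g'\<in>cls g. cls (f' + g')) = (\<Union>f'\<in>cls f. cls (f' + g))"
    by (simp add: mem_cls)
  also have "\<dots> = cls (f + g)"
  proof (rule UN_cls[OF f])
    fix f' assume "f' \<in> free" "f \<simeq> f'"
    with f g show "cls (f' + g) = cls (f + g)"
      by - (rule cls_eqI, simp_all add: eqv_add)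
  qed
  finally show ?thesis by (simp add: tensor_module_def cls_def)
qed

lemma smult_T:
  assumes f: "f \<in> free"
  shows "c \<odot>\<^bsub>T\<^esub> cls f = cls (pm_scale c f)"
proof -
  have "(\<Union>g\<in>cls f. cls (pm_scale c g)) = cls (pm_scale c f)"
  proof (rule UN_cls[OF f])
    fix g assume "g \<in> free" "f \<simeq> g"
    with f show "cls (pm_scale c g) = cls (pm_scale c f)"
      by - (rule cls_eqI, simp_all add: eqv_scale)
  qed
  then show ?thesis by (simp add: tensor_module_def cls_def)
qed

lemma act_T:
  assumes "f \<in> free"
  shows "act T x (cls f) = cls (Act x f)"
proof -
  have "(\<Union>g\<in>cls f. cls (Act x g)) = cls (Act x f)"
  proof (rule UN_cls[OF assms])
    fix g assume "g \<in> free" "f \<simeq> g"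
    with assms show "cls (Act x g) = cls (Act x f)"
      using Act_R[of "f - g" x]
      by - (rule cls_eqI, simp_all add: Act_free eqv_def pm_linear_simps[OF linear_Act])
  qed
  then show ?thesis by (simp add: tensor_module_def Act_def cls_def[symmetric])
qed

end

context phi_tensor_pair
begin

text \<open>Choose a representative of the image of every pure tensor. As these are basis vectors of
  the free space, the choice extends linearly, and modulo relators it induces the given
  isomorphism.\<close>

lemma bms_iso_lift:
  assumes "bms_iso T.T T'.T"
  shows "\<exists>\<phi>. pm_linear \<phi> \<and>
    (\<forall>f\<in>T.free. \<phi> f \<in> T'.free) \<and>
    (\<forall>f\<in>T.free. \<phi> f \<in> T'.R \<longleftrightarrow> f \<in> T.R) \<and>
    (\<forall>f'\<in>T'.free. \<exists>f\<in>T.free. T'.eqv (\<phi> f) f') \<and>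
    (\<forall>x. \<forall>f\<in>T.free. T'.eqv (\<phi> (T.Act x f)) (T'.Act x (\<phi> f)))"
proof -
  from assms obtain \<Phi> where \<Phi>: "bij_betw \<Phi> (carrier T.T) (carrier T'.T) \<and>
     (\<forall>X\<in>carrier T.T. \<forall>Y\<in>carrier T.T. \<Phi> (X \<oplus>\<^bsub>T.T\<^esub> Y) = \<Phi> X \<oplus>\<^bsub>T'.T\<^esub> \<Phi> Y) \<and>
     (\<forall>c. \<forall>X\<in>carrier T.T. \<Phi> (c \<odot>\<^bsub>T.T\<^esub> X) = c \<odot>\<^bsub>T'.T\<^esub> \<Phi> X) \<and>
     (\<forall>x. \<forall>X\<in>carrier T.T. \<Phi> (act T.T x X) = act T'.T x (\<Phi> X))"
    unfolding bms_iso_def by (rule exE)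
  then have bij: "bij_betw \<Phi> (carrier T.T) (carrier T'.T)"
    and add: "\<And>X Y. X \<in> carrier T.T \<Longrightarrow> Y \<in> carrier T.T \<Longrightarrow> \<Phi> (X \<oplus>\<^bsub>T.T\<^esub> Y) = \<Phi> X \<oplus>\<^bsub>T'.T\<^esub> \<Phi> Y"
    and scale: "\<And>c X. X \<in> carrier T.T \<Longrightarrow> \<Phi> (c \<odot>\<^bsub>T.T\<^esub> X) = c \<odot>\<^bsub>T'.T\<^esub> \<Phi> X"
    and act: "\<And>x X. X \<in> carrier T.T \<Longrightarrow> \<Phi> (act T.T x X) = act T'.T x (\<Phi> X)"
    by blast+
  have carrier: "T.cls f \<in> carrier T.T" if "f \<in> T.free" for f
    using that by (simp add: T.carrier_T)
  have ex: "\<exists>g. g \<in> T'.free \<and> T'.cls g = \<Phi> (T.cls f)" if "f \<in> T.free" for f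
  proof -
    have "\<Phi> (T.cls f) \<in> carrier T'.T"
      using bij_betw_apply[OF bij carrier[OF that]] .
    then show ?thesis unfolding T'.carrier_T by auto
  qed
  \<comment> \<open>Only generators receive a meaningful value; on other keys the choice may be
    arbitrary, and \<phi> is controlled on \<open>T.free\<close> alone.\<close>
  define r where "r k = (SOME g. g \<in> T'.free \<and> T'.cls g = \<Phi> (T.cls (Poly_Mapping.single k 1)))" for k
  define \<phi> where "\<phi> = pm_extend r"
  have lin: "pm_linear \<phi>" by (simp add: \<phi>_def pm_linear_extend)
  note simps = pm_linear_simps[OF lin]
  have "T.free \<subseteq> {f \<in> T.free. \<phi> f \<in> T'.free \<and> T'.cls (\<phi> f) = \<Phi> (T.cls f)}" (is "_ \<subseteq> ?S")
  proof (rule T.free_subset)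
    show "pm.subspace ?S"
    proof (rule pm.subspaceI)
      obtain g where "g \<in> T'.free" "T'.cls g = \<Phi> (T.cls 0)" using ex[of 0] by auto
      then have "T'.cls 0 = \<Phi> (T.cls 0)"
        using scale[OF carrier, of 0 0] T'.smult_T[of g 0] by (simp add: T.smult_T)
      then show "0 \<in> ?S" by (simp add: simps)
      show "f + g \<in> ?S" if "f \<in> ?S" "g \<in> ?S" for f g
        using that add[OF carrier carrier, of f g] by (simp add: simps T.add_T T'.add_T[symmetric])
      show "pm_scale c f \<in> ?S" if "f \<in> ?S" for c f
        using that scale[OF carrier, of f c] by (simp add: simps T.smult_T T'.smult_T[symmetric])
    qed
    show "pure u v \<in> ?S" if "(u, v) \<in> T.gens" for u v
      using someI_ex[OF ex[OF T.pure_free[OF that]]] that by (simp add: \<phi>_def r_def)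
  qed
  then have \<phi>: "\<phi> f \<in> T'.free" "T'.cls (\<phi> f) = \<Phi> (T.cls f)" if "f \<in> T.free" for f
    using that by auto
  have inj: "\<Phi> (T.cls f) = \<Phi> (T.cls g) \<longleftrightarrow> T.eqv f g" if "f \<in> T.free" "g \<in> T.free" for f g
    using bij carrier[OF that(1)] carrier[OF that(2)] T.cls_eq_iff[OF that]
    by (auto simp: bij_betw_def dest: inj_onD)
  show ?thesis
  proof (intro exI[of _ \<phi>] conjI ballI allI lin \<phi>(1))
    show "\<phi> f \<in> T'.R \<longleftrightarrow> f \<in> T.R" if f: "f \<in> T.free" for f
    proof -
      have "\<phi> f \<in> T'.R \<longleftrightarrow> T'.cls (\<phi> f) = T'.cls (\<phi> 0)"
        using \<phi>(1)[OF f] by (simp add: T'.cls_eq_iff simps T'.eqv_0_iff)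
      also have "\<dots> \<longleftrightarrow> f \<in> T.R"
        using inj[OF f, of 0] \<phi>(2)[OF f] \<phi>(2)[of 0] by (simp add: T.eqv_0_iff)
      finally show ?thesis .
    qed
    show "\<exists>f\<in>T.free. T'.eqv (\<phi> f) f'" if f': "f' \<in> T'.free" for f'
    proof -
      have "T'.cls f' \<in> \<Phi> ` carrier T.T"
        using f' bij by (simp add: bij_betw_def T'.carrier_T)
      then obtain f where f: "f \<in> T.free" "T'.cls f' = \<Phi> (T.cls f)"
        by (auto simp: T.carrier_T)
      then have "T'.cls (\<phi> f) = T'.cls f'" by (simp add: \<phi>)
      with f f' show ?thesis by (metis T'.cls_eq_iff \<phi>(1))
    qed
    show "T'.eqv (\<phi> (T.Act x f)) (T'.Act x (\<phi> f))" if f: "f \<in> T.free" for x f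
    proof -
      have "T'.cls (\<phi> (T.Act x f)) = T'.cls (T'.Act x (\<phi> f))"
        using act[OF carrier[OF f], of x] f
        by (simp add: \<phi> T.Act_free T.act_T T'.act_T[symmetric])
      then show ?thesis
        using T'.cls_eq_iff[OF \<phi>(1)[OF T.Act_free[OF f]] T'.Act_free[OF \<phi>(1)[OF f]]] by blast
    qed
  qed
qed

text \<open>Both maps preserve relators, so F induces a map of classes; it is injective because F f
  in R' forces f = G (F f) into R.\<close>

lemma bms_iso_of_lift:
  assumes F: "pm_linear F" "\<And>f. f \<in> T.free \<Longrightarrow> F f \<in> T'.free" "\<And>f. f \<in> T.R \<Longrightarrow> F f \<in> T'.R"
    and act: "\<And>x f. f \<in> T.free \<Longrightarrow> F (T.Act x f) = T'.Act x (F f)"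
    and G: "\<And>f. f \<in> T'.free \<Longrightarrow> G f \<in> T.free" "\<And>f. f \<in> T'.R \<Longrightarrow> G f \<in> T.R"
    and GF: "\<And>f. f \<in> T.free \<Longrightarrow> G (F f) = f" and FG: "\<And>f. f \<in> T'.free \<Longrightarrow> F (G f) = f"
  shows "bms_iso T.T T'.T"
proof -
  note simps = pm_linear_simps[OF F(1)]
  define \<Phi> where "\<Phi> X = (\<Union>f\<in>X. T'.cls (F f))" for X
  have \<Phi>: "\<Phi> (T.cls f) = T'.cls (F f)" if "f \<in> T.free" for f
    unfolding \<Phi>_def
  proof (rule T.UN_cls[OF that])
    fix g assume "g \<in> T.free" "T.eqv f g"
    then have "T'.eqv (F g) (F f)"
      using F(3)[of "f - g"] by (intro T'.eqv_sym[of "F f"]) (simp add: T.eqv_def T'.eqv_def simps)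
    then show "T'.cls (F g) = T'.cls (F f)"
      using that \<open>g \<in> T.free\<close> by (simp add: T'.cls_eq_iff F(2))
  qed
  have "bij_betw \<Phi> (carrier T.T) (carrier T'.T)"
  proof (rule bij_betw_imageI)
    show "inj_on \<Phi> (carrier T.T)"
    proof (rule inj_onI)
      fix X Y assume "X \<in> carrier T.T" "Y \<in> carrier T.T" "\<Phi> X = \<Phi> Y"
      then obtain f g where f: "f \<in> T.free" "X = T.cls f" and g: "g \<in> T.free" "Y = T.cls g"
        and "T'.cls (F f) = T'.cls (F g)"
        unfolding T.carrier_T using \<Phi> by auto
      then have "F (f - g) \<in> T'.R"
        by (simp add: T'.cls_eq_iff F(2) simps T'.eqv_def)
      then have "f - g \<in> T.R" using G(2) GF f g by (metis T.free_closed(3))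
      with f g show "X = Y" by (simp add: T.cls_eq_iff T.eqv_def)
    qed
    show "\<Phi> ` carrier T.T = carrier T'.T"
    proof (intro equalityI subsetI)
      fix Y assume "Y \<in> carrier T'.T"
      then obtain f where f: "f \<in> T'.free" "Y = T'.cls f" unfolding T'.carrier_T by auto
      then have "Y = \<Phi> (T.cls (G f))" by (simp add: \<Phi> G FG)
      then show "Y \<in> \<Phi> ` carrier T.T" using f G(1) by (auto simp: T.carrier_T)
    qed (auto simp: T.carrier_T T'.carrier_T \<Phi> F(2))
  qed
  moreover have "\<Phi> (X \<oplus>\<^bsub>T.T\<^esub> Y) = \<Phi> X \<oplus>\<^bsub>T'.T\<^esub> \<Phi> Y"
    if "X \<in> carrier T.T" "Y \<in> carrier T.T" for X Y
    using that unfolding T.carrier_T by (auto simp: T.add_T T'.add_T \<Phi> F(2) simps)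
  moreover have "\<Phi> (c \<odot>\<^bsub>T.T\<^esub> X) = c \<odot>\<^bsub>T'.T\<^esub> \<Phi> X" if "X \<in> carrier T.T" for c X
    using that unfolding T.carrier_T by (auto simp: T.smult_T T'.smult_T \<Phi> F(2) simps)
  moreover have "\<Phi> (act T.T x X) = act T'.T x (\<Phi> X)" if "X \<in> carrier T.T" for x X
    using that unfolding T.carrier_T by (auto simp: T.act_T T'.act_T \<Phi> F(2) act T.Act_free)
  ultimately show ?thesis unfolding bms_iso_def by blast
qed

end

section \<open>Isomorphisms from renumbered parameters\<close>

definition bms_hom :: "('v \<Rightarrow> 'w) \<Rightarrow> 'v bms_mod \<Rightarrow> 'w bms_mod \<Rightarrow> bool" where
  "bms_hom \<psi> V W \<longleftrightarrow> (\<forall>v\<in>carrier V. \<psi> v \<in> carrier W) \<and>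
     (\<forall>u\<in>carrier V. \<forall>v\<in>carrier V. \<psi> (u \<oplus>\<^bsub>V\<^esub> v) = \<psi> u \<oplus>\<^bsub>W\<^esub> \<psi> v) \<and>
     (\<forall>c. \<forall>v\<in>carrier V. \<psi> (c \<odot>\<^bsub>V\<^esub> v) = c \<odot>\<^bsub>W\<^esub> \<psi> v) \<and>
     (\<forall>x. \<forall>v\<in>carrier V. \<psi> (act V x v) = act W x (\<psi> v))"

lemma bms_isoE:
  assumes "bms_iso V W" "bms_module V" "bms_module W"
  obtains \<psi> \<psi>' where "bms_hom \<psi> V W" "bms_hom \<psi>' W V"
    "\<And>v. v \<in> carrier V \<Longrightarrow> \<psi>' (\<psi> v) = v" "\<And>w. w \<in> carrier W \<Longrightarrow> \<psi> (\<psi>' w) = w"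
proof -
  interpret V: bms_module V by fact
  interpret W: bms_module W by fact
  from assms(1) obtain \<psi> where iso: "bij_betw \<psi> (carrier V) (carrier W) \<and>
     (\<forall>u\<in>carrier V. \<forall>v\<in>carrier V. \<psi> (u \<oplus>\<^bsub>V\<^esub> v) = \<psi> u \<oplus>\<^bsub>W\<^esub> \<psi> v) \<and>
     (\<forall>c. \<forall>v\<in>carrier V. \<psi> (c \<odot>\<^bsub>V\<^esub> v) = c \<odot>\<^bsub>W\<^esub> \<psi> v) \<and>
     (\<forall>x. \<forall>v\<in>carrier V. \<psi> (act V x v) = act W x (\<psi> v))"
    unfolding bms_iso_def by (rule exE)
  then have bij: "bij_betw \<psi> (carrier V) (carrier W)" by (rule conjunct1)
  with iso have hom: "bms_hom \<psi> V W"
    by (simp add: bms_hom_def bij_betw_apply)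
  define \<psi>' where "\<psi>' = inv_into (carrier V) \<psi>"
  have closed: "\<psi>' w \<in> carrier V" and right: "\<psi> (\<psi>' w) = w" if "w \<in> carrier W" for w
    using that bij_betw_imp_surj_on[OF bij] unfolding \<psi>'_def
    by (auto intro: inv_into_into f_inv_into_f)
  have left: "\<psi>' (\<psi> v) = v" if "v \<in> carrier V" for v
    unfolding \<psi>'_def using bij that by (simp add: bij_betw_def)
  have eqI: "\<psi>' w = v" if "v \<in> carrier V" "\<psi> v = w" for v w
    using left that by blast
  have "bms_hom \<psi>' W V"
    unfolding bms_hom_def
    using hom closed right V.act_closed
    by (auto intro!: eqI simp: bms_hom_def)
  with that hom left right show ?thesis by blast
qed

text \<open>The index map runs backwards, from the new slots to the old ones, because a family of
  slot entries is renamed by precomposition.\<close>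

definition relabel :: "('j \<Rightarrow> 'i) \<Rightarrow> 'j set \<Rightarrow> ('v \<Rightarrow> 'w) \<Rightarrow>
    (('i \<Rightarrow> 'a) \<times> 'v \<Rightarrow>\<^sub>0 complex) \<Rightarrow> (('j \<Rightarrow> 'a) \<times> 'w \<Rightarrow>\<^sub>0 complex)" where
  "relabel \<sigma> A' \<psi> = pm_extend (\<lambda>(u, v). pure (\<lambda>j\<in>A'. u (\<sigma> j)) (\<psi> v))"

lemma linear_relabel: "pm_linear (relabel \<sigma> A' \<psi>)"
  by (simp add: relabel_def pm_linear_extend)

lemma relabel_pure [simp]: "relabel \<sigma> A' \<psi> (pure u v) = pure (\<lambda>j\<in>A'. u (\<sigma> j)) (\<psi> v)"
  by (simp add: relabel_def)

context phi_tensor_pair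
begin

context
  fixes \<sigma> :: "'j \<Rightarrow> 'i" and \<psi> :: "'v \<Rightarrow> 'w"
  assumes \<sigma>: "bij_betw \<sigma> A' A" and M: "\<And>j. j \<in> A' \<Longrightarrow> T'.M j = T.M (\<sigma> j)"
    and \<psi>: "bms_hom \<psi> V V'"
begin

lemma relabel_gens: "(u, v) \<in> T.gens \<Longrightarrow> (\<lambda>j\<in>A'. u (\<sigma> j), \<psi> v) \<in> T'.gens"
  using \<psi> by (simp add: T.gens_iff T'.gens_iff bms_hom_def)

text \<open>Injectivity of \<sigma> ensures that a changed slot reappears in one place only.\<close>

lemma relabel_upd: "j \<in> A' \<Longrightarrow> (\<lambda>k\<in>A'. (u(\<sigma> j := a)) (\<sigma> k)) = (\<lambda>k\<in>A'. u (\<sigma> k))(j := a)"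
  using bij_betw_imp_inj_on[OF \<sigma>] by (auto simp: fun_eq_iff inj_on_def)

lemma relabel_free: "f \<in> T.free \<Longrightarrow> relabel \<sigma> A' \<psi> f \<in> T'.free"
proof -
  have "T.free \<subseteq> {f. relabel \<sigma> A' \<psi> f \<in> T'.free}"
    by (rule T.free_subset)
       (auto intro!: pm.subspaceI simp: pm_linear_simps[OF linear_relabel] relabel_gens)
  then show "f \<in> T.free \<Longrightarrow> relabel \<sigma> A' \<psi> f \<in> T'.free" by auto
qed

lemma relabel_R: "f \<in> T.R \<Longrightarrow> relabel \<sigma> A' \<psi> f \<in> T'.R"
proof -
  have "T.R \<subseteq> {f. relabel \<sigma> A' \<psi> f \<in> T'.R}"
  proof (rule T.R_subset)
    show "pm.subspace {f. relabel \<sigma> A' \<psi> f \<in> T'.R}"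
      by (rule pm.subspaceI)
         (auto simp: pm_linear_simps[OF linear_relabel] pm.subspace_0 pm.subspace_add pm.subspace_scale)
    fix r assume "r \<in> tensor_relators A T.M V"
    then show "r \<in> {f. relabel \<sigma> A' \<psi> f \<in> T'.R}"
    proof (cases rule: T.relators_cases)
      case (slot_add u v i a b)
      then obtain j where "j \<in> A'" "i = \<sigma> j" using \<sigma> by (auto simp: bij_betw_def)
      with T'.rel_slot_add[OF relabel_gens[OF slot_add(1)], of j a b] show ?thesis
        by (simp add: slot_add(3) pm_linear_simps[OF linear_relabel] relabel_upd del: fun_upd_apply)
    next
      case (slot_scale u v i c a)
      then obtain j where "j \<in> A'" "i = \<sigma> j" using \<sigma> by (auto simp: bij_betw_def)
      with T'.rel_slot_scale[OF relabel_gens[OF slot_scale(1)], of j c a] show ?thesis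
        by (simp add: slot_scale(3) pm_linear_simps[OF linear_relabel] relabel_upd del: fun_upd_apply)
    next
      case (add u v w)
      with T'.rel_add[OF relabel_gens[OF add(1)], of "\<psi> w"] \<psi> T.gens_V[OF add(1)] show ?thesis
        by (simp add: pm_linear_simps[OF linear_relabel] bms_hom_def)
    next
      case (scale u v c)
      with T'.rel_scale[OF relabel_gens[OF scale(1)], of c] \<psi> T.gens_V[OF scale(1)] show ?thesis
        by (simp add: pm_linear_simps[OF linear_relabel] bms_hom_def)
    qed
  qed
  then show "f \<in> T.R \<Longrightarrow> relabel \<sigma> A' \<psi> f \<in> T'.R" by auto
qed

lemma relabel_Act:
  assumes "f \<in> T.free"
  shows "relabel \<sigma> A' \<psi> (T.Act x f) = T'.Act x (relabel \<sigma> A' \<psi> f)"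
proof -
  note simps = pm_linear_simps[OF linear_relabel]
  have "T.free \<subseteq> {f. relabel \<sigma> A' \<psi> (T.Act x f) = T'.Act x (relabel \<sigma> A' \<psi> f)}"
  proof (rule T.free_subset)
    show "pm.subspace {f. relabel \<sigma> A' \<psi> (T.Act x f) = T'.Act x (relabel \<sigma> A' \<psi> f)}"
      by (rule pm.subspaceI)
         (auto simp: simps pm_linear_simps[OF T.linear_Act] pm_linear_simps[OF T'.linear_Act])
    fix u v assume uv: "(u, v) \<in> T.gens"
    have "(\<Sum>i\<in>A. relabel \<sigma> A' \<psi> (pure (u(i := act (T.M i) x (u i))) v))
        = (\<Sum>j\<in>A'. relabel \<sigma> A' \<psi> (pure (u(\<sigma> j := act (T.M (\<sigma> j)) x (u (\<sigma> j)))) v))"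
      by (rule sum.reindex_bij_betw[OF \<sigma>, symmetric])
    also have "\<dots> = (\<Sum>j\<in>A'. pure ((\<lambda>k\<in>A'. u (\<sigma> k))(j := act (T'.M j) x (u (\<sigma> j)))) (\<psi> v))"
      by (rule sum.cong[OF refl]) (simp only: relabel_pure relabel_upd M)
    finally show "pure u v \<in> {f. relabel \<sigma> A' \<psi> (T.Act x f) = T'.Act x (relabel \<sigma> A' \<psi> f)}"
      using \<psi> uv by (simp add: T.Act_eq T'.Act_eq simps bms_hom_def del: fun_upd_apply)
  qed
  with assms show ?thesis by auto
qed

end

lemma relabel_inverse:
  assumes "f \<in> T.free" "\<And>i. i \<in> A \<Longrightarrow> \<sigma>' i \<in> A' \<and> \<sigma> (\<sigma>' i) = i"
    and "\<And>v. v \<in> carrier V \<Longrightarrow> \<psi>' (\<psi> v) = v"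
  shows "relabel \<sigma>' A \<psi>' (relabel \<sigma> A' \<psi> f) = f"
proof -
  have "T.free \<subseteq> {f. relabel \<sigma>' A \<psi>' (relabel \<sigma> A' \<psi> f) = f}"
  proof (rule T.free_subset)
    show "pm.subspace {f. relabel \<sigma>' A \<psi>' (relabel \<sigma> A' \<psi> f) = f}"
      by (rule pm.subspaceI) (auto simp: pm_linear_simps[OF linear_relabel])
    fix u v assume uv: "(u, v) \<in> T.gens"
    then have "(\<lambda>i\<in>A. (\<lambda>j\<in>A'. u (\<sigma> j)) (\<sigma>' i)) = u"
      using assms(2) by (auto simp: T.gens_iff fun_eq_iff extensional_def)
    then show "pure u v \<in> {f. relabel \<sigma>' A \<psi>' (relabel \<sigma> A' \<psi> f) = f}"
      using uv assms(3) by simp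
  qed
  with assms(1) show ?thesis by auto
qed

end

theorem theorem4p2:
  fixes m m' :: nat
    and l \<alpha> \<beta> \<gamma> l' \<alpha>' \<beta>' \<gamma>' :: "nat \<Rightarrow> complex"
    and h g :: "nat \<Rightarrow> complex poly"
    and V :: "'v bms_mod" and V' :: "'w bms_mod"
  assumes "m \<ge> 1" and "m' \<ge> 1"
    and "\<And>i. i \<in> {1..m} \<Longrightarrow> l i \<noteq> 0"
    and "\<And>i. i \<in> {1..m} \<Longrightarrow> \<alpha> i \<noteq> 0 \<or> \<beta> i \<noteq> 0"
    and "\<And>j. j \<in> {1..m'} \<Longrightarrow> l' j \<noteq> 0"
    and "\<And>j. j \<in> {1..m'} \<Longrightarrow> \<alpha>' j \<noteq> 0 \<or> \<beta>' j \<noteq> 0"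
    and "inj_on l {1..m}" and "inj_on l' {1..m'}"
    and "bms_module V" and "bms_irreducible V" and "bms_restricted V"
    and "bms_module V'" and "bms_irreducible V'" and "bms_restricted V'"
  shows "bms_iso
           (tensor_module {1..m} (\<lambda>i. Phi (l i) (\<alpha> i) (\<beta> i) (\<gamma> i) (h i)) V)
           (tensor_module {1..m'} (\<lambda>j. Phi (l' j) (\<alpha>' j) (\<beta>' j) (\<gamma>' j) (g j)) V')
         \<longleftrightarrow> m = m' \<and> bms_iso V V' \<and>
             (\<exists>\<sigma>. \<sigma> permutes {1..m} \<and>
               (\<forall>i\<in>{1..m}. (l i, \<alpha> i, \<beta> i, \<gamma> i, h i) =
                  (l' (\<sigma> i), \<alpha>' (\<sigma> i), \<beta>' (\<sigma> i), \<gamma>' (\<sigma> i), g (\<sigma> i))))"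
proof -
  let ?A = "{1..m}" and ?A' = "{1..m'}"
  interpret phi_tensor_pair ?A l \<alpha> \<beta> \<gamma> h V ?A' l' \<alpha>' \<beta>' \<gamma>' g V'
    by (intro phi_tensor_pair.intro phi_tensor.intro) (use assms in simp_all)
  show ?thesis
  proof
    assume iso: "bms_iso T.T T'.T"
    from bms_iso_lift[OF iso] obtain \<phi> where \<phi>: "pm_linear \<phi> \<and>
      (\<forall>f\<in>T.free. \<phi> f \<in> T'.free) \<and>
      (\<forall>f\<in>T.free. \<phi> f \<in> T'.R \<longleftrightarrow> f \<in> T.R) \<and>
      (\<forall>f'\<in>T'.free. \<exists>f\<in>T.free. T'.eqv (\<phi> f) f') \<and>
      (\<forall>x. \<forall>f\<in>T.free. T'.eqv (\<phi> (T.Act x f)) (T'.Act x (\<phi> f)))"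
      by (rule exE)
    interpret phi_tensor_iso ?A l \<alpha> \<beta> \<gamma> h V ?A' l' \<alpha>' \<beta>' \<gamma>' g V' \<phi>
    proof (intro phi_tensor_iso.intro phi_tensor_iso_axioms.intro phi_tensor_pair_axioms)
      show "pm_linear \<phi>" "\<And>f. f \<in> T.free \<Longrightarrow> \<phi> f \<in> T'.free"
        "\<And>f. f \<in> T.free \<Longrightarrow> \<phi> f \<in> T'.R \<longleftrightarrow> f \<in> T.R"
        "\<And>f'. f' \<in> T'.free \<Longrightarrow> \<exists>f\<in>T.free. T'.eqv (\<phi> f) f'"
        "\<And>x f. f \<in> T.free \<Longrightarrow> T'.eqv (\<phi> (T.Act x f)) (T'.Act x (\<phi> f))"
        using \<phi> by blast+
    qed (use assms in blast)+
    have m: "m = m'"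
      using bij_betw_same_card[OF bij_\<tau>] by simp
    \<comment> \<open>\<open>permutes\<close> demands the identity outside the index set, where
      \<tau> is unspecified.\<close>
    define \<sigma> where "\<sigma> i = (if i \<in> ?A then \<tau> i else i)" for i
    have "bij_betw \<sigma> ?A ?A"
      using bij_\<tau> m by (subst bij_betw_cong[of _ _ \<tau>]) (simp_all add: \<sigma>_def)
    then have "\<sigma> permutes ?A"
      by (rule bij_imp_permutes) (auto simp: \<sigma>_def)
    moreover have "(l i, \<alpha> i, \<beta> i, \<gamma> i, h i)
        = (l' (\<sigma> i), \<alpha>' (\<sigma> i), \<beta>' (\<sigma> i), \<gamma>' (\<sigma> i), g (\<sigma> i))" if i: "i \<in> ?A" for i
      using parameters_eq[OF i \<tau>(1)[OF i] \<tau>(2)[OF i, symmetric]] \<tau>(2)[OF i] i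
      by (simp add: \<sigma>_def)
    ultimately show "m = m' \<and> bms_iso V V' \<and> (\<exists>\<sigma>. \<sigma> permutes ?A \<and>
        (\<forall>i\<in>?A. (l i, \<alpha> i, \<beta> i, \<gamma> i, h i)
          = (l' (\<sigma> i), \<alpha>' (\<sigma> i), \<beta>' (\<sigma> i), \<gamma>' (\<sigma> i), g (\<sigma> i))))"
      using m bms_iso_V by blast
  next
    assume "m = m' \<and> bms_iso V V' \<and> (\<exists>\<sigma>. \<sigma> permutes ?A \<and>
        (\<forall>i\<in>?A. (l i, \<alpha> i, \<beta> i, \<gamma> i, h i)
          = (l' (\<sigma> i), \<alpha>' (\<sigma> i), \<beta>' (\<sigma> i), \<gamma>' (\<sigma> i), g (\<sigma> i))))"
    then obtain \<sigma> where m: "m = m'" and iso: "bms_iso V V'" and \<sigma>: "\<sigma> permutes ?A"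
      and par: "\<forall>i\<in>?A. (l i, \<alpha> i, \<beta> i, \<gamma> i, h i)
          = (l' (\<sigma> i), \<alpha>' (\<sigma> i), \<beta>' (\<sigma> i), \<gamma>' (\<sigma> i), g (\<sigma> i))"
      by blast
    obtain \<psi> \<psi>' where \<psi>: "bms_hom \<psi> V V'" "bms_hom \<psi>' V' V"
      "\<And>v. v \<in> carrier V \<Longrightarrow> \<psi>' (\<psi> v) = v" "\<And>w. w \<in> carrier V' \<Longrightarrow> \<psi> (\<psi>' w) = w"
      by (rule bms_isoE[OF iso T.V T'.V]) blast
    interpret S: phi_tensor_pair ?A' l' \<alpha>' \<beta>' \<gamma>' g V' ?A l \<alpha> \<beta> \<gamma> h V
      by (intro phi_tensor_pair.intro T.phi_tensor_axioms T'.phi_tensor_axioms)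
    \<comment> \<open>Since \<open>relabel\<close> takes its index map backwards, the map from the
      first product to the second uses the inverse permutation, and the map back uses
      \<sigma>.\<close>
    define \<sigma>' where "\<sigma>' = inv_into UNIV \<sigma>"
    have \<sigma>': "\<sigma>' permutes ?A"
      unfolding \<sigma>'_def by (rule permutes_inv[OF \<sigma>])
    have bij: "bij_betw \<sigma> ?A ?A'" "bij_betw \<sigma>' ?A' ?A"
      using permutes_imp_bij[OF \<sigma>] permutes_imp_bij[OF \<sigma>'] m by simp_all
    have inv: "\<sigma> (\<sigma>' i) = i" "\<sigma>' (\<sigma> i) = i" for i
      using permutes_inverses[OF \<sigma>] by (simp_all add: \<sigma>'_def)
    have closed: "\<sigma> i \<in> ?A'" "\<sigma>' i \<in> ?A" if "i \<in> ?A" for i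
      using that permutes_in_image[OF \<sigma>] permutes_in_image[OF \<sigma>'] m by blast+
    have M: "T.M i = T'.M (\<sigma> i)" if "i \<in> ?A" for i
      using par that by simp
    have M': "T'.M j = T.M (\<sigma>' j)" if "j \<in> ?A'" for j
      using M[of "\<sigma>' j"] closed(2) that m by (simp add: inv)
    show "bms_iso T.T T'.T"
    proof (rule bms_iso_of_lift[OF linear_relabel])
      show "relabel \<sigma>' ?A' \<psi> f \<in> T'.free" if "f \<in> T.free" for f
        by (rule relabel_free[OF bij(2) M' \<psi>(1) that])
      show "relabel \<sigma>' ?A' \<psi> f \<in> T'.R" if "f \<in> T.R" for f
        by (rule relabel_R[OF bij(2) M' \<psi>(1) that])
      show "relabel \<sigma>' ?A' \<psi> (T.Act x f) = T'.Act x (relabel \<sigma>' ?A' \<psi> f)"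
        if "f \<in> T.free" for x f
        by (rule relabel_Act[OF bij(2) M' \<psi>(1) that])
      show "relabel \<sigma> ?A \<psi>' f \<in> T.free" if "f \<in> T'.free" for f
        by (rule S.relabel_free[OF bij(1) M \<psi>(2) that])
      show "relabel \<sigma> ?A \<psi>' f \<in> T.R" if "f \<in> T'.R" for f
        by (rule S.relabel_R[OF bij(1) M \<psi>(2) that])
      show "relabel \<sigma> ?A \<psi>' (relabel \<sigma>' ?A' \<psi> f) = f" if "f \<in> T.free" for f
        using that closed(1) by (intro relabel_inverse) (simp_all add: inv \<psi>(3) del: atLeastAtMost_iff)
      show "relabel \<sigma>' ?A' \<psi> (relabel \<sigma> ?A \<psi>' f) = f" if "f \<in> T'.free" for f
        using that closed(2) m by (intro S.relabel_inverse) (simp_all add: inv \<psi>(4) del: atLeastAtMost_iff)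
    qed
  qed
qed

end
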